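(* Let $l_i\in\mathbb{N}_0$, $1\le i\le d$. For $\nu\in\mathbb{N}_0^d$ with $\nu_i\le l_i$ for all $i$, the polynomials $$\phi_\nu(x;\beta,r,l)=\prod_{j=1}^d(\alpha_{1,j}+1)_{\nu_j}Q_{\nu_j}(x_j;\alpha_{1,j},\alpha_{2,j},l_j),$$ where $$\alpha_{1,j}=\beta+|\nu^{j+1}|+|X_{j-1}|,\qquad \alpha_{2,j}=|L_{j-1}|-|X_{j-1}|+|\nu^{j+1}|+r-1,$$ satisfy the difference equation $D\phi_\nu=\lambda_{|\nu|}\phi_\nu$ in $\mathbb{R}[V^d_l]$ (i.e. at every point of $V^d_l$), where $\lambda_n=-n(n+\beta+r)$ and $$D=-\sum_{1\le i,j\le d}x_j(x_i-l_i-\delta_{i,j}r)\triangle_i\nabla_j+\sum_{i=1}^d\big[-(\beta+r+1)x_i+l_i(\beta+1)\big]\triangle_i,$$ and, for $\nu,\mu\le l$ (coordinatewise), the orthogonality relation $$\sum_{x\in V^d_l}\phi_\nu(x;\beta,r,l)\phi_\mu(x;\beta,r,l)\prod_{i=1}^d\frac{(-l_i)_{x_i}}{x_i!}\,\frac{(\beta+1)_{|x|}}{(-|l|-r+1)_{|x|}}=B_\nu\delta_{\nu,\mu},$$ where $$B_\nu=\frac{(-1)^{|\nu|}(1+\beta)_{|\nu|}}{(r+|\nu|)_{|l|-|\nu|}}\prod_{j=1}^d\frac{\nu_j!\,(\beta+r+2|\nu^{j+1}|+\nu_j+|L_{j-1}|)_{l_j+1}}{(-l_j)_{\nu_j}(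\beta+r+2|\nu^j|+|L_{j-1}|)}.$$
   Context: $d>1$; $\triangle_if(x)=f(x+e_i)-f(x)$, $\nabla_if(x)=f(x)-f(x-e_i)$; $(y)_k=y(y+1)\cdots(y+k-1)$, $(y)_0=1$. $V^d_l=\{x\in\mathbb{N}_0^d:x_i\le l_i,\ i=1,\dots,d\}$, $l=(l_1,\dots,l_d)$. $\mathbb{R}[V]$ is the quotient of $\mathbb{R}[x_1,\dots,x_d]$ by the ideal of polynomials vanishing on $V$. For a vector $y$, $|y|$ is the sum of its coordinates; $|\nu^{j}|=\nu_{j}+\dots+\nu_d$ (with $|\nu^{d+1}|=0$), $|X_{j-1}|=x_1+\dots+x_{j-1}$, $|L_{j-1}|=l_1+\dots+l_{j-1}$ (zero for $j=1$). Hahn polynomials in one variable: $$Q_n(x;\alpha,\beta',N)=\sum_{k=0}^n\frac{(-n)_k(n+\alpha+\beta'+1)_k(-x)_k}{(\alpha+1)_k(-N)_k\,k!},\qquad n\le N.$$ The real parameters $\beta,r$ satisfy one of: (i) $\beta>-1$ and $r>0$; (ii) $\beta<-|l|$ and $r<-|l|+1$. In $B_\nu$, the factor $\beta+r+2|\nu^j|+|L_{j-1}|$ is one of the factors of the Pochhammer symbol $(\beta+r+2|\nu^{j+1}|+\nu_j+|L_{j-1}|)_{l_j+1}$ in the numerator; the quotient is understood after cancelling it (relevant if it is zero). *)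

theory Defs
  imports Complex_Main "HOL-Library.FuncSet"
begin

text \<open>
  Vectors are functions on \<open>nat\<close> of which only the coordinates \<open>1, \<dots>, d\<close> matter.
  Lattice points are \<open>nat\<close>-valued and extensional outside \<open>{1..d}\<close>, so that equality of
  functions is equality of lattice points; \<open>real \<circ> x\<close> is the lattice point \<open>x\<close> as a real vector.
\<close>

definition V :: "nat \<Rightarrow> (nat \<Rightarrow> nat) \<Rightarrow> (nat \<Rightarrow> nat) set" where
  "V d l = (\<Pi>\<^sub>E i\<in>{1..d}. {0..l i})"

definition total :: "nat \<Rightarrow> (nat \<Rightarrow> 'a::comm_monoid_add) \<Rightarrow> 'a" where
  "total d y = (\<Sum>i=1..d. y i)"

definition tail :: "nat \<Rightarrow> (nat \<Rightarrow> nat) \<Rightarrow> nat \<Rightarrow> nat" where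
  "tail d \<nu> j = (\<Sum>i=j..d. \<nu> i)"

definition init :: "(nat \<Rightarrow> 'a::comm_monoid_add) \<Rightarrow> nat \<Rightarrow> 'a" where
  "init y j = (\<Sum>i=1..j. y i)"

definition fdiff :: "nat \<Rightarrow> ((nat \<Rightarrow> real) \<Rightarrow> real) \<Rightarrow> (nat \<Rightarrow> real) \<Rightarrow> real" where
  "fdiff i f x = f (x(i := x i + 1)) - f x"

definition bdiff :: "nat \<Rightarrow> ((nat \<Rightarrow> real) \<Rightarrow> real) \<Rightarrow> (nat \<Rightarrow> real) \<Rightarrow> real" where
  "bdiff i f x = f x - f (x(i := x i - 1))"

definition hahnQ :: "nat \<Rightarrow> real \<Rightarrow> real \<Rightarrow> real \<Rightarrow> nat \<Rightarrow> real" where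
  "hahnQ n x \<alpha> \<beta>' N =
     (\<Sum>k=0..n. pochhammer (- real n) k * pochhammer (real n + \<alpha> + \<beta>' + 1) k * pochhammer (- x) k /
        (pochhammer (\<alpha> + 1) k * pochhammer (- real N) k * fact k))"

definition alpha1 :: "nat \<Rightarrow> real \<Rightarrow> (nat \<Rightarrow> nat) \<Rightarrow> (nat \<Rightarrow> real) \<Rightarrow> nat \<Rightarrow> real" where
  "alpha1 d \<beta> \<nu> x j = \<beta> + real (tail d \<nu> (j + 1)) + init x (j - 1)"

definition alpha2 ::
    "nat \<Rightarrow> real \<Rightarrow> (nat \<Rightarrow> nat) \<Rightarrow> (nat \<Rightarrow> nat) \<Rightarrow> (nat \<Rightarrow> real) \<Rightarrow> nat \<Rightarrow> real" where
  "alpha2 d r l \<nu> x j = real (init l (j - 1)) - init x (j - 1) + real (tail d \<nu> (j + 1)) + r - 1"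

text \<open>
  The factor \<open>(\<alpha>\<^sub>1\<^sub>,\<^sub>j + 1)\<^bsub>\<nu>\<^sub>j\<^esub>\<close> clears the \<open>x\<close>-dependent denominators of \<open>Q\<close>, which makes the
  product a polynomial in \<open>x\<close>. At a real \<open>x\<close> where one of these denominators is zero the formula
  below need not give the value of that polynomial, but this never happens on \<open>V d l\<close>
  (\<open>phi_on_V\<close>), and the difference operator at points of \<open>V d l\<close> depends
  on the values on \<open>V d l\<close> only (\<open>diffop_cong\<close>).
\<close>
definition phi ::
    "nat \<Rightarrow> real \<Rightarrow> real \<Rightarrow> (nat \<Rightarrow> nat) \<Rightarrow> (nat \<Rightarrow> nat) \<Rightarrow> (nat \<Rightarrow> real) \<Rightarrow> real" where
  "phi d \<beta> r l \<nu> x =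
     (\<Prod>j=1..d. pochhammer (alpha1 d \<beta> \<nu> x j + 1) (\<nu> j) *
        hahnQ (\<nu> j) (x j) (alpha1 d \<beta> \<nu> x j) (alpha2 d r l \<nu> x j) (l j))"

definition diffop ::
    "nat \<Rightarrow> real \<Rightarrow> real \<Rightarrow> (nat \<Rightarrow> nat) \<Rightarrow> ((nat \<Rightarrow> real) \<Rightarrow> real) \<Rightarrow> (nat \<Rightarrow> real) \<Rightarrow> real" where
  "diffop d \<beta> r l f x =
     - (\<Sum>i=1..d. \<Sum>j=1..d.
          x j * (x i - real (l i) - (if i = j then 1 else 0) * r) * fdiff i (bdiff j f) x)
     + (\<Sum>i=1..d. (- (\<beta> + r + 1) * x i + real (l i) * (\<beta> + 1)) * fdiff i f x)"

definition eigval :: "real \<Rightarrow> real \<Rightarrow> nat \<Rightarrow> real" where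
  "eigval \<beta> r n = - real n * (real n + \<beta> + r)"

definition weight :: "nat \<Rightarrow> real \<Rightarrow> real \<Rightarrow> (nat \<Rightarrow> nat) \<Rightarrow> (nat \<Rightarrow> nat) \<Rightarrow> real" where
  "weight d \<beta> r l x =
     (\<Prod>i=1..d. pochhammer (- real (l i)) (x i) / fact (x i)) *
     (pochhammer (\<beta> + 1) (total d x) / pochhammer (- real (total d l) - r + 1) (total d x))"

text \<open>
  \<open>(a)\<^sub>m / (a + n)\<close> after cancelling the factor \<open>a + n\<close> of \<open>(a)\<^sub>m\<close>, for \<open>n < m\<close>.
\<close>
definition poch_omit :: "real \<Rightarrow> nat \<Rightarrow> nat \<Rightarrow> real" where
  "poch_omit a m n = (\<Prod>k\<in>{0..<m} - {n}. a + real k)"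

lemma poch_omit: "n < m \<Longrightarrow> pochhammer a m = (a + real n) * poch_omit a m n"
  unfolding poch_omit_def pochhammer_prod
  by (subst prod.remove[of _ n]) auto

text \<open>
  The factor removed here is
  \<open>(\<beta> + r + 2|\<nu>\<^bsup>j+1\<^esup>| + \<nu>\<^sub>j + |L\<^bsub>j-1\<^esub>|) + \<nu>\<^sub>j = \<beta> + r + 2|\<nu>\<^bsup>j\<^esup>| + |L\<^bsub>j-1\<^esub>|\<close>.
\<close>
definition B :: "nat \<Rightarrow> real \<Rightarrow> real \<Rightarrow> (nat \<Rightarrow> nat) \<Rightarrow> (nat \<Rightarrow> nat) \<Rightarrow> real" where
  "B d \<beta> r l \<nu> =
     (- 1) ^ total d \<nu> * pochhammer (1 + \<beta>) (total d \<nu>) /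
       pochhammer (r + real (total d \<nu>)) (total d l - total d \<nu>) *
     (\<Prod>j=1..d.
        fact (\<nu> j) *
        poch_omit (\<beta> + r + 2 * real (tail d \<nu> (j + 1)) + real (\<nu> j) + real (init l (j - 1)))
          (l j + 1) (\<nu> j) /
        pochhammer (- real (l j)) (\<nu> j))"

lemma B_quotient:
  assumes "\<nu> \<in> V d l"
    and nz: "\<And>j. j \<in> {1..d} \<Longrightarrow> \<beta> + r + 2 * real (tail d \<nu> j) + real (init l (j - 1)) \<noteq> 0"
  shows "B d \<beta> r l \<nu> =
     (- 1) ^ total d \<nu> * pochhammer (1 + \<beta>) (total d \<nu>) /
       pochhammer (r + real (total d \<nu>)) (total d l - total d \<nu>) *
     (\<Prod>j=1..d.
        fact (\<nu> j) *
        pochhammer (\<beta> + r + 2 * real (tail d \<nu> (j + 1)) + real (\<nu> j) + real (init l (j - 1)))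
          (l j + 1) /
        (pochhammer (- real (l j)) (\<nu> j) *
         (\<beta> + r + 2 * real (tail d \<nu> j) + real (init l (j - 1)))))"
proof -
  have "poch_omit (\<beta> + r + 2 * real (tail d \<nu> (j + 1)) + real (\<nu> j) + real (init l (j - 1)))
          (l j + 1) (\<nu> j) =
        pochhammer (\<beta> + r + 2 * real (tail d \<nu> (j + 1)) + real (\<nu> j) + real (init l (j - 1)))
          (l j + 1) / (\<beta> + r + 2 * real (tail d \<nu> j) + real (init l (j - 1)))"
    if j: "j \<in> {1..d}" for j
  proof -
    have "\<nu> j \<le> l j" using assms(1) j by (auto simp: V_def PiE_def Pi_def)
    moreover have "tail d \<nu> j = \<nu> j + tail d \<nu> (j + 1)"
      using j unfolding tail_def by (simp add: sum.atLeast_Suc_atMost)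
    ultimately have "\<beta> + r + 2 * real (tail d \<nu> j) + real (init l (j - 1)) =
        (\<beta> + r + 2 * real (tail d \<nu> (j + 1)) + real (\<nu> j) + real (init l (j - 1))) + real (\<nu> j)"
      and "\<nu> j < l j + 1"
      by simp_all
    then show ?thesis
      using nz[OF j] poch_omit[of "\<nu> j" "l j + 1"] by (metis nonzero_mult_div_cancel_left)
  qed
  then show ?thesis
    unfolding B_def by (simp add: mult_ac)
qed

lemma phi_on_V:
  assumes par: "(\<beta> > -1 \<and> r > 0) \<or> (\<beta> < - real (total d l) \<and> r < - real (total d l) + 1)"
    and nu: "\<nu> \<in> V d l" and x: "x \<in> V d l"
  shows alpha1_pochhammer_nonzero:
      "\<And>j k. j \<in> {1..d} \<Longrightarrow> k \<le> \<nu> j \<Longrightarrow> pochhammer (alpha1 d \<beta> \<nu> (real \<circ> x) j + 1) k \<noteq> 0"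
    and phi_polynomial_form:
      "phi d \<beta> r l \<nu> (real \<circ> x) =
        (\<Prod>j=1..d. \<Sum>k=0..\<nu> j.
           pochhammer (- real (\<nu> j)) k *
           pochhammer (real (\<nu> j) + \<beta> + 2 * real (tail d \<nu> (j + 1)) + real (init l (j - 1)) + r) k *
           pochhammer (- real (x j)) k *
           pochhammer (alpha1 d \<beta> \<nu> (real \<circ> x) j + 1 + real k) (\<nu> j - k) /
           (pochhammer (- real (l j)) k * fact k))"
proof -
  have nul: "\<nu> i \<le> l i" and xl: "x i \<le> l i" if "i \<in> {1..d}" for i
    using nu x that by (auto simp: V_def PiE_def Pi_def)
  show nz: "pochhammer (alpha1 d \<beta> \<nu> (real \<circ> x) j + 1) k \<noteq> 0"
    if j: "j \<in> {1..d}" and k: "k \<le> \<nu> j" for j k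
  proof -
    have e: "init (real \<circ> x) (j - 1) = real (init x (j - 1))"
      unfolding init_def by simp
    let ?s = "tail d \<nu> (j + 1) + init x (j - 1)"
    have "tail d \<nu> (j + 1) \<le> (\<Sum>i=j+1..d. l i)"
      unfolding tail_def by (rule sum_mono) (use nul j in auto)
    moreover have "init x (j - 1) \<le> (\<Sum>i=1..j - 1. l i)"
      unfolding init_def by (rule sum_mono) (use xl j in auto)
    moreover have "total d l = (\<Sum>i=1..j - 1. l i) + l j + (\<Sum>i=j+1..d. l i)"
    proof -
      have "{1..d} = {1..j - 1} \<union> {j} \<union> {j+1..d}" using j by auto
      moreover have "sum l ({1..j - 1} \<union> {j} \<union> {j+1..d}) =
          (\<Sum>i=1..j - 1. l i) + l j + (\<Sum>i=j+1..d. l i)"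
        using j by (subst sum.union_disjoint; (subst sum.union_disjoint)?) auto
      ultimately show ?thesis unfolding total_def by simp
    qed
    ultimately have "?s + k \<le> total d l" using k nul[OF j] by linarith
    then have s: "real ?s + real k \<le> real (total d l)" by linarith
    have "\<beta> + real ?s + 1 + real i \<noteq> 0" if "i < k" for i
    proof -
      have "real i + 1 \<le> real k" using that by linarith
      then show ?thesis using par s by linarith
    qed
    then have "pochhammer (\<beta> + real ?s + 1) k \<noteq> 0"
      by (auto simp: pochhammer_prod)
    then show ?thesis unfolding alpha1_def e by (simp add: add.assoc)
  qed
  show "phi d \<beta> r l \<nu> (real \<circ> x) =
        (\<Prod>j=1..d. \<Sum>k=0..\<nu> j.
           pochhammer (- real (\<nu> j)) k *
           pochhammer (real (\<nu> j) + \<beta> + 2 * real (tail d \<nu> (j + 1)) + real (init l (j - 1)) + r) k *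
           pochhammer (- real (x j)) k *
           pochhammer (alpha1 d \<beta> \<nu> (real \<circ> x) j + 1 + real k) (\<nu> j - k) /
           (pochhammer (- real (l j)) k * fact k))"
    unfolding phi_def hahnQ_def sum_distrib_left
  proof (intro prod.cong sum.cong refl)
    fix j k assume j: "j \<in> {1..d}" and k: "k \<in> {0..\<nu> j}"
    let ?a = "alpha1 d \<beta> \<nu> (real \<circ> x) j"
    have p: "pochhammer (?a + 1) (\<nu> j) =
        pochhammer (?a + 1) k * pochhammer (?a + 1 + real k) (\<nu> j - k)"
      using k by (intro pochhammer_product) auto
    have s: "real (\<nu> j) + ?a + alpha2 d r l \<nu> (real \<circ> x) j + 1 =
        real (\<nu> j) + \<beta> + 2 * real (tail d \<nu> (j + 1)) + real (init l (j - 1)) + r"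
      by (simp add: alpha1_def alpha2_def)
    show "pochhammer (?a + 1) (\<nu> j) *
        (pochhammer (- real (\<nu> j)) k *
         pochhammer (real (\<nu> j) + ?a + alpha2 d r l \<nu> (real \<circ> x) j + 1) k *
         pochhammer (- (real \<circ> x) j) k /
         (pochhammer (?a + 1) k * pochhammer (- real (l j)) k * fact k)) =
        pochhammer (- real (\<nu> j)) k *
           pochhammer (real (\<nu> j) + \<beta> + 2 * real (tail d \<nu> (j + 1)) + real (init l (j - 1)) + r) k *
           pochhammer (- real (x j)) k *
           pochhammer (?a + 1 + real k) (\<nu> j - k) /
           (pochhammer (- real (l j)) k * fact k)"
      unfolding s p using nz[OF j, of k] k by (simp add: o_def)
  qed
qed

lemma diffop_cong:
  assumes x: "x \<in> V d l" and fg: "\<And>y. y \<in> V d l \<Longrightarrow> f (real \<circ> y) = g (real \<circ> y)"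
  shows "diffop d \<beta> r l f (real \<circ> x) = diffop d \<beta> r l g (real \<circ> x)"
proof -
  define h where "h y = f y - g y" for y
  define z where "z = real \<circ> x"
  have h0: "h (real \<circ> y) = 0" if "y \<in> V d l" for y
    using fg[OF that] by (simp add: h_def)
  have hz: "h z = 0" using h0[OF x] by (simp add: z_def)
  have xl: "x i \<le> l i" if "i \<in> {1..d}" for i
    using x that by (auto simp: V_def PiE_def Pi_def)
  have up: "(z i - real (l i)) * h (z(i := z i + 1)) = 0" if i: "i \<in> {1..d}" for i
  proof (cases "x i = l i")
    case False
    then have "x(i := x i + 1) \<in> V d l"
      using x i xl[OF i] by (auto simp: V_def PiE_def Pi_def extensional_def)
    moreover have "real \<circ> x(i := x i + 1) = z(i := z i + 1)" by (auto simp: z_def fun_eq_iff)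
    ultimately show ?thesis using h0[of "x(i := x i + 1)"] by simp
  qed (simp add: z_def)
  have dn: "z i * h (z(i := z i - 1)) = 0" if i: "i \<in> {1..d}" for i
  proof (cases "x i = 0")
    case False
    then have "x(i := x i - 1) \<in> V d l"
      using x i xl[OF i] by (auto simp: V_def PiE_def Pi_def extensional_def)
    moreover have "real \<circ> x(i := x i - 1) = z(i := z i - 1)"
      using False by (auto simp: z_def fun_eq_iff)
    ultimately show ?thesis using h0[of "x(i := x i - 1)"] by simp
  qed (simp add: z_def)
  have ud: "z j * ((z i - real (l i)) * h (z(i := z i + 1, j := z j - 1))) = 0"
    if i: "i \<in> {1..d}" and j: "j \<in> {1..d}" and ij: "i \<noteq> j" for i j
  proof (cases "x i = l i \<or> x j = 0")
    case False
    let ?y = "x(i := x i + 1, j := x j - 1)"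
    have "?y \<in> V d l"
      using x i j xl[OF i] xl[OF j] False by (auto simp: V_def PiE_def Pi_def extensional_def)
    moreover have "real \<circ> ?y = z(i := z i + 1, j := z j - 1)"
      using False by (auto simp: z_def fun_eq_iff)
    ultimately show ?thesis using h0[of ?y] by simp
  qed (auto simp: z_def)
  have T: "z j * (z i - real (l i) - (if i = j then 1 else 0) * r) * fdiff i (bdiff j h) z =
      (if i = j then - r * z i * h (z(i := z i + 1)) else 0)"
    if i: "i \<in> {1..d}" and j: "j \<in> {1..d}" for i j
  proof (cases "i = j")
    case True
    have "z i * (z i - real (l i) - r) * (h (z(i := z i + 1)) + h (z(i := z i - 1))) =
       z i * ((z i - real (l i)) * h (z(i := z i + 1))) - r * z i * h (z(i := z i + 1)) +
       (z i - real (l i) - r) * (z i * h (z(i := z i - 1)))"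
      by algebra
    then show ?thesis unfolding up[OF i] dn[OF i] using True hz by (simp add: fdiff_def bdiff_def)
  next
    case False
    have "z j * (z i - real (l i)) *
        (h (z(i := z i + 1)) - h (z(i := z i + 1, j := z j - 1)) + h (z(j := z j - 1))) =
       z j * ((z i - real (l i)) * h (z(i := z i + 1)))
       - z j * ((z i - real (l i)) * h (z(i := z i + 1, j := z j - 1)))
       + (z i - real (l i)) * (z j * h (z(j := z j - 1)))"
      by algebra
    then show ?thesis unfolding up[OF i] dn[OF j] ud[OF i j False] using False hz
      by (simp add: fdiff_def bdiff_def)
  qed
  have "diffop d \<beta> r l h z =
     - (\<Sum>i=1..d. \<Sum>j=1..d. if i = j then - r * z i * h (z(i := z i + 1)) else 0)
     + (\<Sum>i=1..d. (- (\<beta> + r + 1) * z i + real (l i) * (\<beta> + 1)) * h (z(i := z i + 1)))"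
    unfolding diffop_def using T hz
    by (intro arg_cong2[of _ _ _ _ "(+)"] arg_cong[of _ _ uminus] sum.cong refl) 
      (auto simp: fdiff_def)
  also have "\<dots> = (\<Sum>i=1..d. - (\<beta> + 1) * ((z i - real (l i)) * h (z(i := z i + 1))))"
    by (simp add: sum.delta sum_negf[symmetric] sum.distrib[symmetric] algebra_simps)
  also have "\<dots> = 0" by (intro sum.neutral ballI) (simp only: up mult_zero_right)
  finally have "diffop d \<beta> r l h z = 0" .
  moreover have "diffop d \<beta> r l h z = diffop d \<beta> r l f z - diffop d \<beta> r l g z"
  proof -
    have 1: "fdiff i h z = fdiff i f z - fdiff i g z"
      and 2: "fdiff i (bdiff j h) z = fdiff i (bdiff j f) z - fdiff i (bdiff j g) z" for i j
      by (simp_all add: fdiff_def bdiff_def h_def)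
    show ?thesis
      unfolding diffop_def 1 2 right_diff_distrib sum_subtractf by simp
  qed
  ultimately show ?thesis by (simp add: z_def)
qed

end

theory Submission
  imports Defs
begin

text \<open>
  Clearing denominators turns \<open>\<phi>\<^sub>\<nu>\<close> into a genuine polynomial, \<open>phi_poly\<close>, of degree at most \<open>|\<nu>|\<close>, and
  the weight takes the form
  \<open>\<Prod>\<^sub>i (l\<^sub>i choose x\<^sub>i) (\<beta>+1)\<^bsub>|x|\<^esub> (r)\<^bsub>|l|-|x|\<^esub> / (r)\<^bsub>|l|\<^esub>\<close>.

  Orthogonality goes by induction on \<open>d\<close>. Only the last factor of \<open>\<phi>\<^sub>\<nu>\<close> contains \<open>x\<^sub>d\<close>, and
  for fixed \<open>x\<^sub>1, \<dots>, x\<^bsub>d-1\<^esub>\<close> the weight is, in \<open>x\<^sub>d\<close>, a multiple of the weight of the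
  one-variable Hahn polynomials with the parameters of that factor (\<open>weight_Suc\<close>). Summing over
  \<open>x\<^sub>d\<close> therefore forces \<open>\<nu>\<^sub>d = \<mu>\<^sub>d\<close>, and for \<open>n = \<nu>\<^sub>d = \<mu>\<^sub>d\<close> the norm that comes out changes the
  remaining weight into the one for \<open>d - 1\<close> variables with \<open>\<beta> + n\<close> and \<open>r + n\<close> in place of \<open>\<beta>\<close>
  and \<open>r\<close> (\<open>weight_shift\<close>); these are also the parameters of the remaining product. The
  one-variable relations follow from the Chu-Vandermonde identity: in the basis
  \<open>(\<beta>' + 1 + N - x)\<^sub>j\<close> the moments of the Hahn polynomial have a closed form with the factor
  \<open>(j + 1 - n)\<^sub>n\<close>, which is zero for \<open>j < n\<close>.
  The same induction shows that \<open>\<phi>\<^sub>\<nu>\<close> is orthogonal to every polynomial of degree less than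
  \<open>|\<nu>|\<close> (\<open>phi_poly_orthogonal_lower_degree\<close>).

  The difference equation is then a general fact on orthogonal polynomials. The operator \<open>D\<close> maps
  a polynomial \<open>f\<close> of degree at most \<open>n\<close> to \<open>\<lambda>\<^sub>n f\<close> plus a polynomial of smaller degree
  (\<open>diffop_leading_term\<close>), and it is self-adjoint for the weight (\<open>diffop_self_adjoint\<close>), because
  it is a combination of the shifts \<open>x \<mapsto> x \<plusminus> e\<^sub>i\<close> and \<open>x \<mapsto> x + e\<^sub>i - e\<^sub>j\<close> with coefficients
  in detailed balance. Hence \<open>g = D \<phi>\<^sub>\<nu> - \<lambda>\<^bsub>|\<nu>|\<^esub> \<phi>\<^sub>\<nu>\<close> has degree less than \<open>|\<nu>|\<close>, and
  \<open>\<langle>g, g\<rangle> = \<langle>\<phi>\<^sub>\<nu>, D g\<rangle> - \<lambda>\<^bsub>|\<nu>|\<^esub> \<langle>\<phi>\<^sub>\<nu>, g\<rangle> = 0\<close>, as \<open>D g\<close> has degree less than \<open>|\<nu>|\<close>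
  too. The weight is positive in both parameter ranges, so \<open>g\<close> vanishes on \<open>V\<close>.
\<close>

section \<open>Finite sums and Pochhammer symbols\<close>

text \<open>
  Reindexing of a finite sum by a bijection of parts of the index sets outside of which
  the summands vanish.
\<close>
lemma sum_reindex_support:
  assumes "finite S" "finite T"
    and g: "\<And>x. x \<in> S \<Longrightarrow> \<not> P x \<Longrightarrow> g x = 0"
    and h: "\<And>y. y \<in> T \<Longrightarrow> \<not> Q y \<Longrightarrow> h y = 0"
    and j: "\<And>x. x \<in> S \<Longrightarrow> P x \<Longrightarrow> i (j x) = x \<and> j x \<in> T \<and> Q (j x) \<and> h (j x) = g x"
    and i: "\<And>y. y \<in> T \<Longrightarrow> Q y \<Longrightarrow> j (i y) = y \<and> i y \<in> S \<and> P (i y)"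
  shows "sum g S = sum h T"
proof -
  have "sum g S = sum g {x \<in> S. P x}"
    using assms(1) g by (intro sum.mono_neutral_right) auto
  also have "\<dots> = sum h {y \<in> T. Q y}"
    using j i by (intro sum.reindex_bij_witness[where i = i and j = j]) auto
  also have "\<dots> = sum h T"
    using assms(2) h by (intro sum.mono_neutral_left) auto
  finally show ?thesis .
qed

text \<open>
  The Chu-Vandermonde identity without denominators.
\<close>
lemma pochhammer_vandermonde_alt:
  fixes a c :: real
  shows "(\<Sum>k\<le>n. (- 1) ^ k * real (n choose k) * pochhammer a k * pochhammer (c + real k) (n - k))
    = pochhammer (c - a) n"
proof -
  have "pochhammer (c + real k) (n - k) = (- 1) ^ (n - k) * pochhammer (1 - c - real n) (n - k)"
    if "k \<le> n" for k
    using pochhammer_minus[of "c + real n - 1" "n - k"] that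
    by (simp add: of_nat_diff algebra_simps)
  then have "(\<Sum>k\<le>n. (- 1) ^ k * real (n choose k) * pochhammer a k * pochhammer (c + real k) (n - k))
      = (\<Sum>k\<le>n. (- 1) ^ n * (real (n choose k) * pochhammer a k * pochhammer (1 - c - real n) (n - k)))"
    by (intro sum.cong refl) (auto simp: power_add[symmetric])
  also have "\<dots> = (- 1) ^ n * pochhammer (a + (1 - c - real n)) n"
    by (simp add: pochhammer_binomial_sum sum_distrib_left)
  also have "\<dots> = pochhammer (c - a) n"
    using pochhammer_minus[of "c - a + real n - 1" n] by (simp add: algebra_simps)
  finally show ?thesis .
qed

lemma pochhammer_neg_nat_eq:
  assumes "k \<le> n"
  shows "pochhammer (- real n) k = (- 1) ^ k * (fact n / fact (n - k))"
proof -
  have "fact n = fact (n - k) * pochhammer (real n - real k + 1) k"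
    using pochhammer_product'[of "1 :: real" "n - k" k] assms
    by (simp add: pochhammer_fact of_nat_diff add.commute)
  then show ?thesis
    by (simp add: pochhammer_minus)
qed

lemma pochhammer_neg_nat_nonzero: "k \<le> N \<Longrightarrow> pochhammer (- real N) k \<noteq> (0::real)"
  by (auto simp: pochhammer_eq_0_iff)

lemma pochhammer_neg_nat_binomial:
  "k \<le> N \<Longrightarrow> pochhammer (- real N) k / fact k = (- 1) ^ k * real (N choose k)"
  by (simp add: pochhammer_neg_nat_eq binomial_fact)

section \<open>Hahn polynomials in one variable\<close>

lemma binomial_times_pochhammer_neg:
  assumes "k \<le> x" "x \<le> N"
  shows "real (N choose x) * pochhammer (- real x) k
    = pochhammer (- real N) k * real ((N - k) choose (x - k))"
proof -
  have "N - k - (x - k) = N - x" using assms by simp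
  then show ?thesis
    using assms by (simp add: pochhammer_neg_nat_eq binomial_fact mult_ac)
qed

text \<open>
  With \<open>a = \<alpha> + 1\<close> and \<open>b = \<beta>' + 1\<close>, the product \<open>(N choose x) (a)\<^sub>x (b)\<^bsub>N-x\<^esub>\<close> is the weight of the
  Hahn polynomials up to a constant factor. The factor \<open>(-x)\<^sub>k\<close> combines with \<open>(N choose x) (a)\<^sub>x\<close>
  and the factor \<open>(b + N - x)\<^sub>j\<close> with \<open>(b)\<^bsub>N-x\<^esub>\<close>, so that the sum is again of Chu-Vandermonde type.
\<close>
lemma hahn_weight_moment:
  fixes a b :: real
  assumes "k \<le> N"
  shows "(\<Sum>x\<le>N. real (N choose x) * pochhammer a x * pochhammer b (N - x) *
        (pochhammer (- real x) k * pochhammer (b + real N - real x) j))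
    = pochhammer (- real N) k * pochhammer a k * pochhammer b j *
        pochhammer (a + b + real k + real j) (N - k)"
proof -
  have "(\<Sum>x\<le>N. real (N choose x) * pochhammer a x * pochhammer b (N - x) *
        (pochhammer (- real x) k * pochhammer (b + real N - real x) j))
    = (\<Sum>y\<le>N - k. pochhammer (- real N) k * pochhammer a k * pochhammer b j *
       (real ((N - k) choose y) * pochhammer (a + real k) y * pochhammer (b + real j) (N - k - y)))"
  proof (rule sum_reindex_support[where P = "\<lambda>x. k \<le> x" and Q = "\<lambda>_. True"
        and i = "\<lambda>y. y + k" and j = "\<lambda>x. x - k"])
    fix x assume x: "x \<in> {..N}" "k \<le> x"
    then have 1: "pochhammer a x = pochhammer a k * pochhammer (a + real k) (x - k)"
      by (intro pochhammer_product) auto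
    have "pochhammer b (N - x) * pochhammer (b + real N - real x) j = pochhammer b (N - x + j)"
      unfolding pochhammer_product' using x by (simp add: of_nat_diff algebra_simps)
    also have "\<dots> = pochhammer b j * pochhammer (b + real j) (N - k - (x - k))"
      using x by (simp add: pochhammer_product'[symmetric] add.commute)
    finally have 2: "pochhammer b (N - x) * pochhammer (b + real N - real x) j
        = pochhammer b j * pochhammer (b + real j) (N - k - (x - k))" .
    have 3: "real (N choose x) * pochhammer (- real x) k
        = pochhammer (- real N) k * real ((N - k) choose (x - k))"
      using x by (intro binomial_times_pochhammer_neg) auto
    have "real (N choose x) * pochhammer a x * pochhammer b (N - x) *
        (pochhammer (- real x) k * pochhammer (b + real N - real x) j)
      = (real (N choose x) * pochhammer (- real x) k) * pochhammer a x *
        (pochhammer b (N - x) * pochhammer (b + real N - real x) j)"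
      by simp
    then have "pochhammer (- real N) k * pochhammer a k * pochhammer b j *
       (real ((N - k) choose (x - k)) * pochhammer (a + real k) (x - k) *
        pochhammer (b + real j) (N - k - (x - k)))
      = real (N choose x) * pochhammer a x * pochhammer b (N - x) *
        (pochhammer (- real x) k * pochhammer (b + real N - real x) j)"
      unfolding 1 2 3 by (simp only: mult_ac)
    then show "x - k + k = x \<and> x - k \<in> {..N - k} \<and> True \<and>
       pochhammer (- real N) k * pochhammer a k * pochhammer b j *
       (real ((N - k) choose (x - k)) * pochhammer (a + real k) (x - k) *
        pochhammer (b + real j) (N - k - (x - k)))
      = real (N choose x) * pochhammer a x * pochhammer b (N - x) *
        (pochhammer (- real x) k * pochhammer (b + real N - real x) j)"
      using x by auto
  qed (use assms in \<open>auto simp: pochhammer_of_nat_eq_0_iff\<close>)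
  also have "\<dots> = pochhammer (- real N) k * pochhammer a k * pochhammer b j *
      pochhammer (a + real k + (b + real j)) (N - k)"
    by (simp add: pochhammer_binomial_sum sum_distrib_left)
  finally show ?thesis
    by (simp add: add_ac)
qed

text \<open>
  The Hahn polynomial in the form in which its denominators are cleared:
  with \<open>a = \<alpha> + 1\<close> and \<open>s = n + \<alpha> + \<beta>' + 1\<close> it is \<open>(\<alpha> + 1)\<^sub>n Q\<^sub>n(x; \<alpha>, \<beta>', N)\<close>.
  As \<open>s\<close> is kept as a separate parameter, the polynomial dependence on \<open>a\<close> is visible.
\<close>
definition hahn_poly :: "nat \<Rightarrow> nat \<Rightarrow> real \<Rightarrow> real \<Rightarrow> real \<Rightarrow> real" where
  "hahn_poly n N a s x =
     (\<Sum>k\<le>n. pochhammer (- real n) k * pochhammer s k * pochhammer (- x) k *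
        pochhammer (a + real k) (n - k) / (pochhammer (- real N) k * fact k))"

text \<open>
  The factor \<open>(j + 1 - n)\<^sub>n\<close> on the right vanishes for \<open>j < n\<close>; this is the orthogonality of the
  Hahn polynomial to all polynomials of degree less than \<open>n\<close>. No nonvanishing of \<open>(a)\<^sub>n\<close> or
  \<open>(b)\<^sub>N\<close> is needed.
\<close>
lemma hahn_poly_moment:
  fixes a b :: real
  assumes "n \<le> N"
  shows "(\<Sum>x\<le>N. real (N choose x) * pochhammer a x * pochhammer b (N - x) *
        (hahn_poly n N a (real n + a + b - 1) (real x) * pochhammer (b + real N - real x) j))
    = pochhammer a n * pochhammer b j * pochhammer (real j + 1 - real n) n *
        pochhammer (a + b + real j + real n) (N - n)"
proof -
  define s where "s = real n + a + b - 1"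
  define A where "A k = pochhammer (- real n) k * pochhammer s k *
    pochhammer (a + real k) (n - k) / (pochhammer (- real N) k * fact k)" for k
  have "(\<Sum>x\<le>N. real (N choose x) * pochhammer a x * pochhammer b (N - x) *
        (hahn_poly n N a s (real x) * pochhammer (b + real N - real x) j))
    = (\<Sum>x\<le>N. \<Sum>k\<le>n. A k * (real (N choose x) * pochhammer a x * pochhammer b (N - x) *
        (pochhammer (- real x) k * pochhammer (b + real N - real x) j)))"
    unfolding hahn_poly_def sum_distrib_left sum_distrib_right
    by (intro sum.cong refl) (simp add: A_def)
  also have "\<dots> = (\<Sum>k\<le>n. A k * (\<Sum>x\<le>N. real (N choose x) * pochhammer a x *
        pochhammer b (N - x) * (pochhammer (- real x) k * pochhammer (b + real N - real x) j)))"
    by (subst sum.swap) (simp add: sum_distrib_left)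
  also have "\<dots> = (\<Sum>k\<le>n. A k * (pochhammer (- real N) k * pochhammer a k * pochhammer b j *
        pochhammer (a + b + real k + real j) (N - k)))"
    using assms by (intro sum.cong refl) (simp add: hahn_weight_moment)
  also have "\<dots> = (\<Sum>k\<le>n. pochhammer a n * pochhammer b j *
        pochhammer (a + b + real j + real n) (N - n) *
        ((- 1) ^ k * real (n choose k) * pochhammer s k * pochhammer (a + b + real j + real k) (n - k)))"
  proof (intro sum.cong refl)
    fix k assume "k \<in> {..n}"
    then have k: "k \<le> n" by simp
    have 1: "pochhammer a n = pochhammer a k * pochhammer (a + real k) (n - k)"
      using k by (rule pochhammer_product)
    have "pochhammer (a + b + real j + real k) ((n - k) + (N - n)) =
        pochhammer (a + b + real j + real k) (n - k) * pochhammer (a + b + real j + real n) (N - n)"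
      using k by (simp only: pochhammer_product') (simp add: of_nat_diff add_ac)
    then have 2: "pochhammer (a + b + real k + real j) (N - k) =
        pochhammer (a + b + real j + real k) (n - k) * pochhammer (a + b + real j + real n) (N - n)"
      using k assms by (simp add: add_ac)
    have 3: "pochhammer (- real n) k / fact k = (- 1) ^ k * real (n choose k)"
      using k by (rule pochhammer_neg_nat_binomial)
    have 4: "pochhammer (- real N) k \<noteq> 0"
      using k assms by (intro pochhammer_neg_nat_nonzero) simp
    have "A k * (pochhammer (- real N) k * pochhammer a k * pochhammer b j *
        pochhammer (a + b + real k + real j) (N - k))
      = pochhammer (- real n) k / fact k * pochhammer s k *
        (pochhammer a k * pochhammer (a + real k) (n - k)) * pochhammer b j *
        pochhammer (a + b + real k + real j) (N - k)"
      using 4 by (simp add: A_def)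
    then show "A k * (pochhammer (- real N) k * pochhammer a k * pochhammer b j *
        pochhammer (a + b + real k + real j) (N - k))
      = pochhammer a n * pochhammer b j * pochhammer (a + b + real j + real n) (N - n) *
        ((- 1) ^ k * real (n choose k) * pochhammer s k * pochhammer (a + b + real j + real k) (n - k))"
      unfolding 2 3 1[symmetric] by (simp only: mult_ac)
  qed
  also have "\<dots> = pochhammer a n * pochhammer b j * pochhammer (a + b + real j + real n) (N - n) *
      pochhammer (a + b + real j - s) n"
    by (simp only: sum_distrib_left[symmetric] pochhammer_vandermonde_alt)
  finally show ?thesis
    by (simp add: s_def algebra_simps)
qed

lemma pochhammer_neg_gap_zero: "j < n \<Longrightarrow> pochhammer (real j + 1 - real n) n = 0"
  by (auto simp: pochhammer_eq_0_iff of_nat_diff intro!: exI[of _ "n - 1 - j"])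

text \<open>
  The polynomial \<open>(-x)\<^sub>m\<close> has leading coefficient \<open>1\<close> in the basis
  \<open>(b + N - x)\<^sub>j\<close>, and the terms with \<open>j < n\<close> are orthogonal to the Hahn polynomial.
\<close>
lemma hahn_poly_moment_neg:
  fixes a b :: real
  assumes "n \<le> N" "m \<le> n"
  shows "(\<Sum>x\<le>N. real (N choose x) * pochhammer a x * pochhammer b (N - x) *
        (hahn_poly n N a (real n + a + b - 1) (real x) * pochhammer (- real x) m))
    = (if m = n then pochhammer a n * pochhammer b n * fact n *
        pochhammer (a + b + 2 * real n) (N - n) else 0)"
proof -
  let ?W = "\<lambda>x. real (N choose x) * pochhammer a x * pochhammer b (N - x)"
  let ?q = "\<lambda>x. hahn_poly n N a (real n + a + b - 1) (real x)"
  (* the expansion is the Vandermonde identity for - x = (b + N - x) + (- b - N) *)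
  have e: "pochhammer (- real x) m = (\<Sum>j\<le>m. real (m choose j) *
      pochhammer (b + real N - real x) j * pochhammer (- b - real N) (m - j))" for x
    using pochhammer_binomial_sum[of "b + real N - real x" "- b - real N" m] by simp
  have "(\<Sum>x\<le>N. ?W x * (?q x * pochhammer (- real x) m))
    = (\<Sum>x\<le>N. \<Sum>j\<le>m. real (m choose j) * pochhammer (- b - real N) (m - j) *
        (?W x * (?q x * pochhammer (b + real N - real x) j)))"
    unfolding e sum_distrib_left by (intro sum.cong refl) simp
  also have "\<dots> = (\<Sum>j\<le>m. real (m choose j) * pochhammer (- b - real N) (m - j) *
        (\<Sum>x\<le>N. ?W x * (?q x * pochhammer (b + real N - real x) j)))"
    by (subst sum.swap) (simp add: sum_distrib_left)
  also have "\<dots> = (\<Sum>j\<le>m. real (m choose j) * pochhammer (- b - real N) (m - j) *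
        (pochhammer a n * pochhammer b j * pochhammer (real j + 1 - real n) n *
        pochhammer (a + b + real j + real n) (N - n)))"
    by (simp only: hahn_poly_moment[OF assms(1)])
  also have "\<dots> = (\<Sum>j\<le>m. if j = n then pochhammer a n * pochhammer b n * fact n *
        pochhammer (a + b + 2 * real n) (N - n) else 0)"
  proof (intro sum.cong refl)
    fix j assume "j \<in> {..m}"
    then consider "j = n" "m = n" | "j < n" using assms(2) by fastforce
    then show "real (m choose j) * pochhammer (- b - real N) (m - j) *
        (pochhammer a n * pochhammer b j * pochhammer (real j + 1 - real n) n *
        pochhammer (a + b + real j + real n) (N - n)) =
        (if j = n then pochhammer a n * pochhammer b n * fact n *
        pochhammer (a + b + 2 * real n) (N - n) else 0)"
      by cases (simp_all only: pochhammer_neg_gap_zero, simp_all add: pochhammer_fact algebra_simps)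
  qed
  also have "\<dots> = (if m = n then pochhammer a n * pochhammer b n * fact n *
        pochhammer (a + b + 2 * real n) (N - n) else 0)"
    using assms(2) by (auto simp: sum.delta)
  finally show ?thesis .
qed

text \<open>
  Of the polynomial of the lower degree \<open>m \<le> n\<close> only a term of degree \<open>n\<close> contributes.
  The norm involves \<open>(s)\<^sub>n (s + n + 1)\<^bsub>N-n\<^esub>\<close> with \<open>s = n + a + b - 1\<close>, which is \<open>(s)\<^bsub>N+1\<^esub>\<close> without
  the factor \<open>s + n\<close>.
\<close>
lemma hahn_poly_orthogonal_le:
  fixes a b :: real
  assumes "n \<le> N" "m \<le> n"
  shows "(\<Sum>x\<le>N. real (N choose x) * pochhammer a x * pochhammer b (N - x) *
        (hahn_poly n N a (real n + a + b - 1) (real x) *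
         hahn_poly m N a (real m + a + b - 1) (real x)))
    = (if m = n then (- 1) ^ n * fact n * pochhammer a n * pochhammer b n *
        poch_omit (real n + a + b - 1) (N + 1) n / pochhammer (- real N) n else 0)"
proof -
  let ?W = "\<lambda>x. real (N choose x) * pochhammer a x * pochhammer b (N - x)"
  let ?q = "\<lambda>x. hahn_poly n N a (real n + a + b - 1) (real x)"
  define A where "A k = pochhammer (- real m) k * pochhammer (real m + a + b - 1) k *
    pochhammer (a + real k) (m - k) / (pochhammer (- real N) k * fact k)" for k
  have "(\<Sum>x\<le>N. ?W x * (?q x * hahn_poly m N a (real m + a + b - 1) (real x)))
    = (\<Sum>x\<le>N. \<Sum>k\<le>m. A k * (?W x * (?q x * pochhammer (- real x) k)))"
    unfolding hahn_poly_def[of m] sum_distrib_left by (intro sum.cong refl) (simp add: A_def)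
  also have "\<dots> = (\<Sum>k\<le>m. A k * (\<Sum>x\<le>N. ?W x * (?q x * pochhammer (- real x) k)))"
    by (subst sum.swap) (simp add: sum_distrib_left)
  also have "\<dots> = (\<Sum>k\<le>m. if k = n then A n * (pochhammer a n * pochhammer b n * fact n *
        pochhammer (a + b + 2 * real n) (N - n)) else 0)"
    using assms by (intro sum.cong refl) (simp add: hahn_poly_moment_neg)
  also have "\<dots> = (if m = n then A n * (pochhammer a n * pochhammer b n * fact n *
        pochhammer (a + b + 2 * real n) (N - n)) else 0)"
    using assms by (auto simp: sum.delta)
  also have "\<dots> = (if m = n then (- 1) ^ n * fact n * pochhammer a n * pochhammer b n *
        (pochhammer (real n + a + b - 1) n * pochhammer (real n + a + b - 1 + real (Suc n)) (N - n))
        / pochhammer (- real N) n else 0)"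
    by (auto simp: A_def pochhammer_same algebra_simps)
  also have "pochhammer (real n + a + b - 1) n * pochhammer (real n + a + b - 1 + real (Suc n)) (N - n)
      = poch_omit (real n + a + b - 1) (N + 1) n"
  proof -
    have "{0..<N + 1} - {n} = {0..<n} \<union> {Suc n..<Suc n + (N - n)}" using assms by auto
    moreover have "(\<Prod>k\<in>{Suc n..<Suc n + (N - n)}. z + real k)
        = pochhammer (z + real (Suc n)) (N - n)" for z :: real
      using prod.shift_bounds_nat_ivl[of "\<lambda>k. z + real k" 0 "Suc n" "N - n"]
      by (simp add: pochhammer_prod add_ac)
    ultimately show ?thesis
      unfolding poch_omit_def by (simp add: prod.union_disjoint pochhammer_prod)
  qed
  finally show ?thesis .
qed

lemma hahn_poly_orthogonal:
  fixes a b :: real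
  assumes "n \<le> N" "m \<le> N"
  shows "(\<Sum>x\<le>N. real (N choose x) * pochhammer a x * pochhammer b (N - x) *
        (hahn_poly n N a (real n + a + b - 1) (real x) *
         hahn_poly m N a (real m + a + b - 1) (real x)))
    = (if n = m then (- 1) ^ n * fact n * pochhammer a n * pochhammer b n *
        poch_omit (real n + a + b - 1) (N + 1) n / pochhammer (- real N) n else 0)"
proof (cases "m \<le> n")
  case True
  then show ?thesis using hahn_poly_orthogonal_le[OF assms(1) True, of a b] by (simp add: eq_commute)
next
  case False
  then show ?thesis using hahn_poly_orthogonal_le[OF assms(2), of n a b] by (simp add: mult.commute)
qed

section \<open>The lattice and the weight\<close>

lemma total_Suc: "total (Suc d) y = total d y + y (Suc d)"
  by (simp add: total_def)

lemma init_eq_total: "init y j = total j y"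
  by (simp add: init_def total_def)

lemma total_cong: "(\<And>i. i \<in> {1..d} \<Longrightarrow> x i = y i) \<Longrightarrow> total d x = total d y"
  unfolding total_def by (rule sum.cong) auto

lemma total_update_Suc: "total d (y(Suc d := c)) = total d y"
  by (rule total_cong) auto

lemma total_of_nat: "total d (real \<circ> x) = real (total d x)"
  by (simp add: total_def)

lemma tail_Suc: "j \<le> Suc d \<Longrightarrow> tail (Suc d) \<nu> j = tail d \<nu> j + \<nu> (Suc d)"
  by (simp add: tail_def)

lemma tail_self: "tail d \<nu> (Suc d) = 0"
  by (simp add: tail_def)

lemma V_le: "x \<in> V d l \<Longrightarrow> i \<in> {1..d} \<Longrightarrow> x i \<le> l i"
  by (auto simp: V_def PiE_def Pi_def)

lemma total_mono: "(\<And>i. i \<in> {1..d} \<Longrightarrow> x i \<le> l i) \<Longrightarrow> total d x \<le> total d (l :: nat \<Rightarrow> nat)"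
  unfolding total_def by (rule sum_mono) auto

lemma V_total_le: "x \<in> V d l \<Longrightarrow> total d x \<le> total d l"
  by (intro total_mono V_le)

lemma V_update_Suc: "x \<in> V d l \<Longrightarrow> y \<le> l (Suc d) \<Longrightarrow> x(Suc d := y) \<in> V (Suc d) l"
  by (auto simp: V_def PiE_def Pi_def extensional_def)

lemma finite_V: "finite (V d l)"
  unfolding V_def by (rule finite_PiE) auto

lemma V_0: "V 0 l = {\<lambda>_. undefined}"
  by (simp add: V_def)

lemma sum_V_Suc:
  "sum F (V (Suc d) l) = (\<Sum>x\<in>V d l. \<Sum>y\<le>l (Suc d). F (x(Suc d := y)))"
proof -
  have 1: "{1..Suc d} = insert (Suc d) {1..d}" by auto
  have "sum F (V (Suc d) l) = sum F ((\<lambda>(y, g). g(Suc d := y)) ` ({0..l (Suc d)} \<times> V d l))"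
    unfolding V_def 1 PiE_insert_eq ..
  also have "\<dots> = (\<Sum>(y, x)\<in>{0..l (Suc d)} \<times> V d l. F (x(Suc d := y)))"
    unfolding V_def by (subst sum.reindex[OF inj_combinator]) (auto simp: case_prod_unfold)
  also have "\<dots> = (\<Sum>y\<in>{0..l (Suc d)}. \<Sum>x\<in>V d l. F (x(Suc d := y)))"
    by (rule sum.cartesian_product[symmetric])
  finally show ?thesis
    by (subst sum.swap) (simp add: atLeast0AtMost)
qed

text \<open>
  A form of the weight free of signs, which makes its dependence on the last coordinate and
  on the parameters visible.
\<close>
lemma weight_eq:
  assumes "pochhammer r (total d l) \<noteq> 0" and x: "x \<in> V d l"
  shows "weight d \<beta> r l x = (\<Prod>i=1..d. real (l i choose x i)) * pochhammer (\<beta> + 1) (total d x) *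
    pochhammer r (total d l - total d x) / pochhammer r (total d l)"
proof -
  let ?X = "total d x" and ?L = "total d l"
  have XL: "?X \<le> ?L" using x by (rule V_total_le)
  have "(\<Prod>i=1..d. pochhammer (- real (l i)) (x i) / fact (x i))
      = (\<Prod>i=1..d. (- 1) ^ x i * real (l i choose x i))"
    using V_le[OF x] by (intro prod.cong refl) (simp add: pochhammer_neg_nat_binomial)
  also have "\<dots> = (- 1) ^ ?X * (\<Prod>i=1..d. real (l i choose x i))"
    by (simp add: prod.distrib power_sum total_def)
  finally have 1: "(\<Prod>i=1..d. pochhammer (- real (l i)) (x i) / fact (x i))
      = (- 1) ^ ?X * (\<Prod>i=1..d. real (l i choose x i))" .
  have 2: "pochhammer (- real ?L - r + 1) ?X = (- 1) ^ ?X * pochhammer (r + real (?L - ?X)) ?X"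
    using pochhammer_minus[of "real ?L + r - 1" ?X] XL by (simp add: of_nat_diff algebra_simps)
  have 3: "pochhammer r ?L = pochhammer r (?L - ?X) * pochhammer (r + real (?L - ?X)) ?X"
    using pochhammer_product'[of r "?L - ?X" ?X] XL by simp
  show ?thesis
    using assms(1) unfolding weight_def 1 2 3 by (simp add: field_simps)
qed

text \<open>
  As a function of the last coordinate \<open>y\<close> the weight is a multiple of the Hahn weight with
  \<open>\<alpha> = \<beta> + |x|\<close> and \<open>\<beta>' = r + |l| - |x| - 1\<close>, where \<open>|x|\<close> and \<open>|l|\<close> are sums over the first \<open>d\<close>
  coordinates.
\<close>
lemma weight_Suc:
  assumes nz: "pochhammer r (total (Suc d) l) \<noteq> 0" and x: "x \<in> V d l" and y: "y \<le> l (Suc d)"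
  shows "weight (Suc d) \<beta> r l (x(Suc d := y)) =
    weight d \<beta> r l x / pochhammer (r + real (total d l)) (l (Suc d)) *
    (real (l (Suc d) choose y) * pochhammer (\<beta> + 1 + real (total d x)) y *
     pochhammer (r + real (total d l) - real (total d x)) (l (Suc d) - y))"
proof -
  let ?X = "total d x" and ?L = "total d l" and ?N = "l (Suc d)"
  have XL: "?X \<le> ?L" using x by (rule V_total_le)
  have 1: "pochhammer r (?L + ?N) = pochhammer r ?L * pochhammer (r + real ?L) ?N"
    by (rule pochhammer_product')
  have nz': "pochhammer r ?L \<noteq> 0" using nz unfolding total_Suc 1 by simp
  have 2: "pochhammer (\<beta> + 1) (?X + y) = pochhammer (\<beta> + 1) ?X * pochhammer (\<beta> + 1 + real ?X) y"
    by (rule pochhammer_product')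
  have "?L + ?N - (?X + y) = (?L - ?X) + (?N - y)" using XL y by simp
  then have 3: "pochhammer r (?L + ?N - (?X + y)) =
      pochhammer r (?L - ?X) * pochhammer (r + real ?L - real ?X) (?N - y)"
    by (simp only: pochhammer_product') (use XL in \<open>simp add: of_nat_diff add_diff_eq\<close>)
  have W: "weight (Suc d) \<beta> r l (x(Suc d := y)) =
      (\<Prod>i=1..Suc d. real (l i choose (x(Suc d := y)) i)) * pochhammer (\<beta> + 1) (?X + y) *
      pochhammer r (?L + ?N - (?X + y)) / pochhammer r (?L + ?N)"
    using weight_eq[OF nz V_update_Suc[OF x y], of \<beta>]
    by (simp add: total_Suc total_update_Suc)
  have P: "(\<Prod>i=1..Suc d. real (l i choose (x(Suc d := y)) i))
      = (\<Prod>i=1..d. real (l i choose x i)) * real (?N choose y)"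
    by simp
  show ?thesis
    unfolding W P 1 2 3 weight_eq[OF nz' x]
    by (simp only: times_divide_eq_left divide_divide_eq_left times_divide_eq_right mult_ac)
qed

lemma sum_weight_Suc:
  assumes nz: "pochhammer r (total (Suc d) l) \<noteq> 0"
  shows "(\<Sum>x\<in>V (Suc d) l. G x * weight (Suc d) \<beta> r l x) =
    (\<Sum>x\<in>V d l. weight d \<beta> r l x / pochhammer (r + real (total d l)) (l (Suc d)) *
      (\<Sum>y\<le>l (Suc d). real (l (Suc d) choose y) * pochhammer (\<beta> + 1 + real (total d x)) y *
        pochhammer (r + real (total d l) - real (total d x)) (l (Suc d) - y) * G (x(Suc d := y))))"
  unfolding sum_V_Suc sum_distrib_left
  by (intro sum.cong refl) (simp add: weight_Suc[OF nz] mult_ac)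

lemma pochhammer_add_nonzero:
  assumes "pochhammer r (m + k) \<noteq> (0 :: real)"
  shows "pochhammer r m \<noteq> 0" "pochhammer (r + real m) k \<noteq> 0"
  using assms by (auto simp: pochhammer_product')

text \<open>
  The factors \<open>(\<alpha> + 1)\<^sub>n (\<beta>' + 1)\<^sub>n\<close>, which the norm and the nonzero moments of the last Hahn
  polynomial contribute, raise both parameters of the weight by \<open>n\<close>.
\<close>
lemma weight_shift:
  assumes nz: "pochhammer r (total d l + n) \<noteq> 0" and x: "x \<in> V d l"
  shows "weight d \<beta> r l x * (pochhammer (\<beta> + 1 + real (total d x)) n *
      pochhammer (r + real (total d l) - real (total d x)) n) =
    pochhammer (\<beta> + 1) n * pochhammer (r + real (total d l)) n *
      weight d (\<beta> + real n) (r + real n) l x"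
proof -
  let ?X = "total d x" and ?L = "total d l"
  have XL: "?X \<le> ?L" using x by (rule V_total_le)
  have nz1: "pochhammer r ?L \<noteq> 0" using pochhammer_add_nonzero[OF nz] by simp
  have nz2: "pochhammer (r + real n) ?L \<noteq> 0"
    using pochhammer_add_nonzero(2)[of r n ?L] nz by (simp add: add.commute)
  have 1: "pochhammer (\<beta> + 1) ?X * pochhammer (\<beta> + 1 + real ?X) n =
      pochhammer (\<beta> + 1) n * pochhammer (\<beta> + real n + 1) ?X"
    using pochhammer_product'[of "\<beta> + 1" ?X n] pochhammer_product'[of "\<beta> + 1" n ?X]
    by (simp add: add_ac)
  have 2: "pochhammer r (?L - ?X) * pochhammer (r + real ?L - real ?X) n =
      pochhammer r n * pochhammer (r + real n) (?L - ?X)"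
    using pochhammer_product'[of r "?L - ?X" n] pochhammer_product'[of r n "?L - ?X"] XL
    by (simp add: add.commute of_nat_diff add_diff_eq)
  have 3: "pochhammer r ?L * pochhammer (r + real ?L) n = pochhammer r n * pochhammer (r + real n) ?L"
    using pochhammer_product'[of r ?L n] pochhammer_product'[of r n ?L] by (simp add: add.commute)
  let ?P = "\<Prod>i=1..d. real (l i choose x i)"
  have "weight d \<beta> r l x * (pochhammer (\<beta> + 1 + real ?X) n * pochhammer (r + real ?L - real ?X) n)
    = ?P * (pochhammer (\<beta> + 1) ?X * pochhammer (\<beta> + 1 + real ?X) n) *
      (pochhammer r (?L - ?X) * pochhammer (r + real ?L - real ?X) n) / pochhammer r ?L"
    unfolding weight_eq[OF nz1 x] by simp
  also have "\<dots> = ?P * pochhammer (\<beta> + 1) n * pochhammer (\<beta> + real n + 1) ?X *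
      pochhammer (r + real n) (?L - ?X) * (pochhammer r n / pochhammer r ?L)"
    unfolding 1 2 by simp
  also have "pochhammer r n / pochhammer r ?L =
      pochhammer (r + real ?L) n / pochhammer (r + real n) ?L"
    using 3 nz1 nz2 by (simp add: frac_eq_eq mult.commute)
  finally show ?thesis
    unfolding weight_eq[OF nz2 x] by simp
qed

section \<open>Orthogonality\<close>

text \<open>
  The polynomial with the values of \<open>\<phi>\<^sub>\<nu>\<close> on the lattice: in every factor the denominators are
  cleared. In the parameter \<open>s\<close> of the Hahn polynomial the dependence on \<open>x\<close> cancels, as
  \<open>\<alpha>\<^sub>1\<^sub>,\<^sub>j + \<alpha>\<^sub>2\<^sub>,\<^sub>j\<close> does not depend on \<open>x\<close>.
\<close>
definition phi_poly ::
    "nat \<Rightarrow> real \<Rightarrow> real \<Rightarrow> (nat \<Rightarrow> nat) \<Rightarrow> (nat \<Rightarrow> nat) \<Rightarrow> (nat \<Rightarrow> real) \<Rightarrow> real" where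
  "phi_poly d \<beta> r l \<nu> x =
     (\<Prod>j=1..d. hahn_poly (\<nu> j) (l j) (alpha1 d \<beta> \<nu> x j + 1)
        (real (\<nu> j) + \<beta> + 2 * real (tail d \<nu> (j + 1)) + real (init l (j - 1)) + r) (x j))"

lemma phi_eq_phi_poly:
  assumes "(\<beta> > -1 \<and> r > 0) \<or> (\<beta> < - real (total d l) \<and> r < - real (total d l) + 1)"
    and "\<nu> \<in> V d l" "x \<in> V d l"
  shows "phi d \<beta> r l \<nu> (real \<circ> x) = phi_poly d \<beta> r l \<nu> (real \<circ> x)"
  unfolding phi_polynomial_form[OF assms] phi_poly_def hahn_poly_def
  by (simp add: atLeast0AtMost)

text \<open>
  Splitting off the last factor: the remaining ones form the polynomial in \<open>d\<close> variables
  with both parameters raised by \<open>n\<close>, since \<open>n\<close> is contained in all tails of \<open>\<nu>\<close>.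
\<close>
lemma phi_poly_Suc:
  fixes x :: "nat \<Rightarrow> nat" and \<nu> :: "nat \<Rightarrow> nat" and d :: nat
  defines "n \<equiv> \<nu> (Suc d)"
  shows "phi_poly (Suc d) \<beta> r l \<nu> (real \<circ> x(Suc d := y)) =
    phi_poly d (\<beta> + real n) (r + real n) l \<nu> (real \<circ> x) *
    hahn_poly n (l (Suc d)) (\<beta> + 1 + real (total d x))
      (real n + (\<beta> + 1 + real (total d x)) + (r + real (total d l) - real (total d x)) - 1) (real y)"
proof -
  have i: "init (real \<circ> x(Suc d := y)) j = init (real \<circ> x) j" if "j \<le> d" for j
    unfolding init_def using that by (intro sum.cong) auto
  have "(\<Prod>j=1..d. hahn_poly (\<nu> j) (l j) (alpha1 (Suc d) \<beta> \<nu> (real \<circ> x(Suc d := y)) j + 1)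
        (real (\<nu> j) + \<beta> + 2 * real (tail (Suc d) \<nu> (j + 1)) + real (init l (j - 1)) + r)
        ((real \<circ> x(Suc d := y)) j))
     = phi_poly d (\<beta> + real n) (r + real n) l \<nu> (real \<circ> x)"
    unfolding phi_poly_def
    by (intro prod.cong refl arg_cong2[where f = "\<lambda>a s. hahn_poly _ _ a s _"])
       (auto simp: alpha1_def tail_Suc n_def i algebra_simps)
  moreover have "hahn_poly (\<nu> (Suc d)) (l (Suc d)) (alpha1 (Suc d) \<beta> \<nu> (real \<circ> x(Suc d := y)) (Suc d) + 1)
        (real (\<nu> (Suc d)) + \<beta> + 2 * real (tail (Suc d) \<nu> (Suc d + 1)) + real (init l (Suc d - 1)) + r)
        ((real \<circ> x(Suc d := y)) (Suc d)) =
    hahn_poly n (l (Suc d)) (\<beta> + 1 + real (total d x))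
      (real n + (\<beta> + 1 + real (total d x)) + (r + real (total d l) - real (total d x)) - 1) (real y)"
    using tail_self[of "Suc d" \<nu>] i[of d]
    by (simp add: alpha1_def n_def init_eq_total total_of_nat add_ac)
  ultimately show ?thesis
    unfolding phi_poly_def[of "Suc d"] by simp
qed

text \<open>
  The norming constants satisfy the recursion which comes from summing over the last coordinate.
\<close>
lemma B_Suc:
  fixes n :: nat
  assumes "n \<le> l (Suc d)" and \<nu>: "\<And>i. i \<in> {1..d} \<Longrightarrow> \<nu> i \<le> l i" and n: "\<nu> (Suc d) = n"
    and nz: "pochhammer (r + real (total d l)) n \<noteq> 0"
  shows "B (Suc d) \<beta> r l \<nu> = (- 1) ^ n * fact n * pochhammer (\<beta> + 1) n *
      pochhammer (r + real (total d l)) n / pochhammer (r + real (total d l)) (l (Suc d)) *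
      poch_omit (\<beta> + r + real n + real (total d l)) (l (Suc d) + 1) n / pochhammer (- real (l (Suc d))) n *
      B d (\<beta> + real n) (r + real n) l \<nu>"
proof -
  let ?\<nu> = "total d \<nu>" and ?L = "total d l" and ?N = "l (Suc d)"
  let ?f = "\<lambda>d \<beta> r j. fact (\<nu> j) *
        poch_omit (\<beta> + r + 2 * real (tail d \<nu> (j + 1)) + real (\<nu> j) + real (init l (j - 1)))
          (l j + 1) (\<nu> j) / pochhammer (- real (l j)) (\<nu> j)"
  have le: "?\<nu> \<le> ?L" using \<nu> by (rule total_mono)
  have 1: "pochhammer (1 + \<beta>) (?\<nu> + n) = pochhammer (\<beta> + 1) n * pochhammer (1 + (\<beta> + real n)) ?\<nu>"
    using pochhammer_product'[of "1 + \<beta>" n ?\<nu>] by (simp add: add_ac)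
  have "?L + ?N - (?\<nu> + n) = (?L - ?\<nu>) + (?N - n)" using le assms(1) by simp
  then have 2: "pochhammer (r + real (?\<nu> + n)) (?L + ?N - (?\<nu> + n)) =
      pochhammer (r + real n + real ?\<nu>) (?L - ?\<nu>) * pochhammer (r + real ?L + real n) (?N - n)"
    by (simp only: pochhammer_product') (use le in \<open>simp add: of_nat_diff add_ac\<close>)
  have 3: "pochhammer (r + real ?L) ?N = pochhammer (r + real ?L) n * pochhammer (r + real ?L + real n) (?N - n)"
    using assms(1) by (rule pochhammer_product)
  have 4: "(\<Prod>j=1..d. ?f (Suc d) \<beta> r j) = (\<Prod>j=1..d. ?f d (\<beta> + real n) (r + real n) j)"
    by (intro prod.cong refl) (simp add: tail_Suc n algebra_simps)
  have 5: "?f (Suc d) \<beta> r (Suc d) = fact n * poch_omit (\<beta> + r + real n + real ?L) (?N + 1) n /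
      pochhammer (- real ?N) n"
    using tail_self[of "Suc d" \<nu>] by (simp add: n init_eq_total)
  have "B (Suc d) \<beta> r l \<nu> = (- 1) ^ (?\<nu> + n) * pochhammer (1 + \<beta>) (?\<nu> + n) /
      pochhammer (r + real (?\<nu> + n)) (?L + ?N - (?\<nu> + n)) *
      ((\<Prod>j=1..d. ?f (Suc d) \<beta> r j) * ?f (Suc d) \<beta> r (Suc d))"
    unfolding B_def total_Suc n by (simp add: n)
  then show ?thesis
    unfolding 1 2 3 4 5 B_def using nz by (simp add: power_add mult_ac)
qed

text \<open>
  The condition \<open>(r)\<^bsub>|l|\<^esub> \<noteq> 0\<close> says that the denominators of the weight do not vanish; it
  passes on to \<open>r + n\<close> and the first \<open>d\<close> variables because \<open>n \<le> l\<^bsub>d+1\<^esub>\<close>.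
\<close>
theorem phi_poly_orthogonal:
  assumes "pochhammer r (total d l) \<noteq> 0"
    and "\<And>i. i \<in> {1..d} \<Longrightarrow> \<nu> i \<le> l i" "\<And>i. i \<in> {1..d} \<Longrightarrow> \<mu> i \<le> l i"
  shows "(\<Sum>x\<in>V d l. phi_poly d \<beta> r l \<nu> (real \<circ> x) * phi_poly d \<beta> r l \<mu> (real \<circ> x) * weight d \<beta> r l x)
    = (if \<forall>i\<in>{1..d}. \<nu> i = \<mu> i then B d \<beta> r l \<nu> else 0)"
  using assms
proof (induction d arbitrary: \<beta> r)
  case 0
  show ?case by (simp add: V_0 phi_poly_def weight_def B_def total_def)
next
  case (Suc d)
  define n where "n = \<nu> (Suc d)"
  define m where "m = \<mu> (Suc d)"
  let ?L = "total d l" and ?N = "l (Suc d)"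
  let ?a = "\<lambda>x. \<beta> + 1 + real (total d x)" and ?b = "\<lambda>x. r + real ?L - real (total d x)"
  let ?c = "(- 1) ^ n * fact n * poch_omit (\<beta> + r + real n + real ?L) (?N + 1) n /
    pochhammer (- real ?N) n"
  let ?p = "\<lambda>n \<nu> x. phi_poly d (\<beta> + real n) (r + real n) l \<nu> (real \<circ> x)"
  have n: "n \<le> ?N" and m: "m \<le> ?N" using Suc.prems(2,3) by (auto simp: n_def m_def)
  have nzL: "pochhammer r (?L + n) \<noteq> 0"
    using pochhammer_neq_0_mono[OF Suc.prems(1), of "?L + n"] n by (simp add: total_Suc)
  have nzn: "pochhammer (r + real n) ?L \<noteq> 0"
    using pochhammer_add_nonzero(2)[of r n ?L] nzL by (simp add: add.commute)
  have nzl: "pochhammer (r + real ?L) n \<noteq> 0"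
    using pochhammer_add_nonzero(2)[OF nzL] .
  have inner: "(\<Sum>y\<le>?N. real (?N choose y) * pochhammer (?a x) y * pochhammer (?b x) (?N - y) *
        (phi_poly (Suc d) \<beta> r l \<nu> (real \<circ> x(Suc d := y)) * phi_poly (Suc d) \<beta> r l \<mu> (real \<circ> x(Suc d := y))))
      = ?p n \<nu> x * ?p m \<mu> x * (if n = m then ?c * (pochhammer (?a x) n * pochhammer (?b x) n) else 0)" for x
  proof -
    have "(\<Sum>y\<le>?N. real (?N choose y) * pochhammer (?a x) y * pochhammer (?b x) (?N - y) *
        (phi_poly (Suc d) \<beta> r l \<nu> (real \<circ> x(Suc d := y)) * phi_poly (Suc d) \<beta> r l \<mu> (real \<circ> x(Suc d := y))))
      = ?p n \<nu> x * ?p m \<mu> x *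
       (\<Sum>y\<le>?N. real (?N choose y) * pochhammer (?a x) y * pochhammer (?b x) (?N - y) *
         (hahn_poly n ?N (?a x) (real n + ?a x + ?b x - 1) (real y) *
          hahn_poly m ?N (?a x) (real m + ?a x + ?b x - 1) (real y)))"
      unfolding sum_distrib_left phi_poly_Suc n_def[symmetric] m_def[symmetric]
      by (intro sum.cong refl) (simp only: mult_ac)
    also have "\<dots> = ?p n \<nu> x * ?p m \<mu> x *
        (if n = m then ?c * (pochhammer (?a x) n * pochhammer (?b x) n) else 0)"
    proof -
      have s: "real n + ?a x + ?b x - 1 = \<beta> + r + real n + real ?L" by simp
      show ?thesis
        unfolding hahn_poly_orthogonal[OF n m] unfolding s by simp
    qed
    finally show ?thesis .
  qed
  show ?case
  proof (cases "n = m")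
    case False
    then have "\<not> (\<forall>i\<in>{1..Suc d}. \<nu> i = \<mu> i)" unfolding n_def m_def by auto
    then show ?thesis
      unfolding sum_weight_Suc[OF Suc.prems(1)] inner using False by auto
  next
    case True
    have "(\<Sum>x\<in>V (Suc d) l. phi_poly (Suc d) \<beta> r l \<nu> (real \<circ> x) * phi_poly (Suc d) \<beta> r l \<mu> (real \<circ> x) *
          weight (Suc d) \<beta> r l x)
      = (\<Sum>x\<in>V d l. ?c / pochhammer (r + real ?L) ?N * (?p n \<nu> x * ?p n \<mu> x) *
          (weight d \<beta> r l x * (pochhammer (?a x) n * pochhammer (?b x) n)))"
      unfolding sum_weight_Suc[OF Suc.prems(1)] inner using True by (simp add: mult_ac)
    also have "\<dots> = ?c * pochhammer (\<beta> + 1) n * pochhammer (r + real ?L) n / pochhammer (r + real ?L) ?N *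
      (\<Sum>x\<in>V d l. ?p n \<nu> x * ?p n \<mu> x * weight d (\<beta> + real n) (r + real n) l x)"
      unfolding sum_distrib_left
      by (intro sum.cong refl) (simp add: weight_shift[OF nzL])
    also have "(\<Sum>x\<in>V d l. ?p n \<nu> x * ?p n \<mu> x * weight d (\<beta> + real n) (r + real n) l x)
      = (if \<forall>i\<in>{1..d}. \<nu> i = \<mu> i then B d (\<beta> + real n) (r + real n) l \<nu> else 0)"
      using Suc.prems by (intro Suc.IH nzn) auto
    also have "(\<forall>i\<in>{1..d}. \<nu> i = \<mu> i) \<longleftrightarrow> (\<forall>i\<in>{1..Suc d}. \<nu> i = \<mu> i)"
      using True unfolding n_def m_def by (auto simp: le_Suc_eq)
    also have "?c * pochhammer (\<beta> + 1) n * pochhammer (r + real ?L) n / pochhammer (r + real ?L) ?N *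
        (if \<forall>i\<in>{1..Suc d}. \<nu> i = \<mu> i then B d (\<beta> + real n) (r + real n) l \<nu> else 0)
      = (if \<forall>i\<in>{1..Suc d}. \<nu> i = \<mu> i then B (Suc d) \<beta> r l \<nu> else 0)"
      using B_Suc[where n = n and l = l and d = d and \<nu> = \<nu> and \<beta> = \<beta>,
          OF n _ n_def[symmetric] nzl] Suc.prems(2) by (simp add: mult_ac)
    finally show ?thesis .
  qed
qed


section \<open>Polynomial functions and their degrees\<close>

text \<open>
  \<open>deg_less d n f\<close>: the function \<open>f\<close> is a polynomial in the coordinates \<open>1, \<dots>, d\<close> of total degree
  less than \<open>n\<close>. The strict bound admits \<open>n = 0\<close>, where only the zero polynomial is left.
\<close>
inductive deg_less :: "nat \<Rightarrow> nat \<Rightarrow> ((nat \<Rightarrow> real) \<Rightarrow> real) \<Rightarrow> bool" for d where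
  zero: "deg_less d n (\<lambda>_. 0)"
| const: "deg_less d (Suc n) (\<lambda>_. c)"
| coord: "i \<in> {1..d} \<Longrightarrow> deg_less d n f \<Longrightarrow> deg_less d (Suc n) (\<lambda>x. x i * f x)"
| add: "deg_less d n f \<Longrightarrow> deg_less d n g \<Longrightarrow> deg_less d n (\<lambda>x. f x + g x)"

lemma deg_less_0: "deg_less d 0 f \<Longrightarrow> f x = 0"
  by (induction "0 :: nat" f rule: deg_less.induct) auto

lemma deg_less_Suc: "deg_less d n f \<Longrightarrow> deg_less d (Suc n) f"
  by (induction rule: deg_less.induct) (auto intro: deg_less.intros)

lemma deg_less_mono:
  assumes "deg_less d n f" "n \<le> m"
  shows "deg_less d m f"
  using assms(2,1) by (induction m rule: dec_induct) (auto intro: deg_less_Suc)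

lemma deg_less_scale: "deg_less d n f \<Longrightarrow> deg_less d n (\<lambda>x. c * f x)"
proof (induction rule: deg_less.induct)
  case (coord i n f)
  then show ?case using deg_less.coord[of i d n "\<lambda>x. c * f x"] by (simp add: mult.left_commute)
next
  case (add n f g)
  then show ?case using deg_less.add[OF add.IH] by (simp add: distrib_left)
qed (auto intro: deg_less.intros)

lemma deg_less_sum:
  assumes "finite A" "\<And>a. a \<in> A \<Longrightarrow> deg_less d n (f a)"
  shows "deg_less d n (\<lambda>x. \<Sum>a\<in>A. f a x)"
  using assms by (induction A rule: finite_induct) (auto intro: deg_less.intros)

lemma deg_less_affine:
  assumes "deg_less d n f" "S \<subseteq> {1..d}"
  shows "deg_less d (Suc n) (\<lambda>x. f x * (c + e * (\<Sum>i\<in>S. x i)))"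
proof -
  have fin: "finite S" using assms(2) finite_subset by blast
  have "deg_less d (Suc n) (\<lambda>x. c * f x + e * (\<Sum>i\<in>S. x i * f x))"
    using assms by (intro deg_less.add deg_less_scale deg_less_sum[OF fin] deg_less.coord
        deg_less_Suc[OF assms(1)]) auto
  then show ?thesis by (simp add: algebra_simps sum_distrib_left sum_distrib_right)
qed

lemma deg_less_pochhammer:
  assumes "deg_less d n f" "S \<subseteq> {1..d}"
  shows "deg_less d (n + k) (\<lambda>x. f x * pochhammer (c + e * (\<Sum>i\<in>S. x i)) k)"
proof (induction k)
  case 0
  then show ?case using assms by simp
next
  case (Suc k)
  show ?case
    using deg_less_affine[OF Suc assms(2), of "c + real k" e] by (simp add: pochhammer_Suc algebra_simps)
qed

lemma deg_less_hahn_poly: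
  assumes f: "deg_less d m f" and S: "S \<subseteq> {1..d}" and j: "j \<in> {1..d}"
  shows "deg_less d (m + n) (\<lambda>x. f x * hahn_poly n N (c + (\<Sum>i\<in>S. x i)) s (x j))"
proof -
  have "deg_less d (m + n) (\<lambda>x. \<Sum>k\<le>n. pochhammer (- real n) k * pochhammer s k /
      (pochhammer (- real N) k * fact k) *
      (f x * pochhammer (- x j) k * pochhammer (c + real k + (\<Sum>i\<in>S. x i)) (n - k)))"
  proof (intro deg_less_sum deg_less_scale)
    fix k assume "k \<in> {..n}"
    then have e: "m + n = m + k + (n - k)" by simp
    have "deg_less d (m + k) (\<lambda>x. f x * pochhammer (- x j) k)"
      using deg_less_pochhammer[OF f, of "{j}" k 0 "- 1"] j by simp
    from deg_less_pochhammer[OF this S, of "n - k" "c + real k" 1]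
    show "deg_less d (m + n)
        (\<lambda>x. f x * pochhammer (- x j) k * pochhammer (c + real k + (\<Sum>i\<in>S. x i)) (n - k))"
      unfolding e by simp
  qed simp
  moreover have "(\<Sum>k\<le>n. pochhammer (- real n) k * pochhammer s k /
      (pochhammer (- real N) k * fact k) *
      (f x * pochhammer (- x j) k * pochhammer (c + real k + (\<Sum>i\<in>S. x i)) (n - k)))
      = f x * hahn_poly n N (c + (\<Sum>i\<in>S. x i)) s (x j)" for x
    unfolding hahn_poly_def sum_distrib_left by (intro sum.cong refl) (simp add: add_ac)
  ultimately show ?thesis by simp
qed

lemma deg_less_phi_poly: "deg_less d (Suc (total d \<nu>)) (phi_poly d \<beta> r l \<nu>)"
proof -
  have "deg_less d (Suc (\<Sum>j=1..k. \<nu> j)) (\<lambda>x. \<Prod>j=1..k. hahn_poly (\<nu> j) (l j) (alpha1 d \<beta> \<nu> x j + 1)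
        (real (\<nu> j) + \<beta> + 2 * real (tail d \<nu> (j + 1)) + real (init l (j - 1)) + r) (x j))"
    if "k \<le> d" for k
    using that
  proof (induction k)
    case 0
    show ?case using deg_less.const[of d 0 1] by simp
  next
    case (Suc k)
    then have "deg_less d (Suc (\<Sum>j=1..k. \<nu> j)) (\<lambda>x. \<Prod>j=1..k. hahn_poly (\<nu> j) (l j) (alpha1 d \<beta> \<nu> x j + 1)
        (real (\<nu> j) + \<beta> + 2 * real (tail d \<nu> (j + 1)) + real (init l (j - 1)) + r) (x j))" by simp
    from deg_less_hahn_poly[OF this, of "{1..k}" "Suc k" "\<nu> (Suc k)" "l (Suc k)"
        "\<beta> + real (tail d \<nu> (Suc k + 1)) + 1"
        "real (\<nu> (Suc k)) + \<beta> + 2 * real (tail d \<nu> (Suc k + 1)) + real (init l k) + r"] Suc.prems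
    show ?case by (simp add: alpha1_def init_def add_ac)
  qed
  from this[of d] show ?thesis unfolding phi_poly_def total_def by simp
qed

text \<open>
  A linear functional vanishes on all polynomials of degree less than \<open>M\<close> in \<open>d + 1\<close> variables
  if it vanishes on the products \<open>q(x\<^sub>1, \<dots>, x\<^sub>d) (c - |x|)\<^sub>k\<close> of such degrees, because
  \<open>x\<^bsub>d+1\<^esub> (c - |x|)\<^sub>k = (c + k - x\<^sub>1 - \<dots> - x\<^sub>d) (c - |x|)\<^sub>k - (c - |x|)\<^bsub>k+1\<^esub>\<close>.
\<close>
section \<open>Orthogonality to all polynomials of lower degree\<close>

lemma weighted_sum_zero_last_variable:
  assumes p: "deg_less (Suc d) M p"
    and base: "\<And>m q k. deg_less d m q \<Longrightarrow> m + k \<le> M \<Longrightarrow>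
      (\<Sum>x\<in>A. W x * (q (real \<circ> x) * pochhammer (c - total (Suc d) (real \<circ> x)) k)) = 0"
  shows "(\<Sum>x\<in>A. W x * p (real \<circ> x)) = 0"
proof -
  let ?I = "\<lambda>f. \<Sum>x\<in>A. W x * f (real \<circ> x)"
  (* the degree of p is moved to q and k one coordinate at a time; as both bounds n and m are
     strict, the bound on their sum is Suc M *)
  have "?I (\<lambda>x. p x * (q x * pochhammer (c - total (Suc d) x) k)) = 0"
    if "deg_less (Suc d) n p" "deg_less d m q" "n + m + k \<le> Suc M" for n p m q k
    using that
  proof (induction arbitrary: m q k rule: deg_less.induct)
    case (zero n)
    then show ?case by simp
  next
    case (const n e)
    then show ?case using base[OF deg_less_scale[OF const(1), of e], of k] by (simp add: mult.assoc o_def)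
  next
    case (coord i n f)
    show ?case
    proof (cases "i = Suc d")
      case False
      then have i: "i \<in> {1..d}" using coord.hyps by auto
      then show ?thesis
        using coord.IH[OF deg_less.coord[OF i coord.prems(1)], of k] coord.prems
        by (simp add: mult_ac)
    next
      case True
      let ?q = "\<lambda>x. q x * (c + real k + - 1 * (\<Sum>i\<in>{1..d}. x i))"
      have q: "deg_less d (Suc m) ?q"
        by (rule deg_less_affine[OF coord.prems(1)]) simp
      have "x i * f x * (q x * pochhammer (c - total (Suc d) x) k) =
          f x * (?q x * pochhammer (c - total (Suc d) x) k) -
          f x * (q x * pochhammer (c - total (Suc d) x) (Suc k))" for x :: "nat \<Rightarrow> real"
        unfolding True by (simp add: total_Suc pochhammer_Suc total_def algebra_simps)
      then have "?I (\<lambda>x. x i * f x * (q x * pochhammer (c - total (Suc d) x) k)) =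
          ?I (\<lambda>x. f x * (?q x * pochhammer (c - total (Suc d) x) k)) -
          ?I (\<lambda>x. f x * (q x * pochhammer (c - total (Suc d) x) (Suc k)))"
        by (simp only: right_diff_distrib sum_subtractf)
      then show ?thesis
        using coord.IH[OF q, of k] coord.IH[OF coord.prems(1), of "Suc k"] coord.prems
        by (simp add: o_def)
    qed
  next
    case (add n f g)
    then show ?case by (simp add: distrib_left distrib_right sum.distrib)
  qed
  from this[OF p deg_less.const[of d 0 1], of 0] show ?thesis by simp
qed

lemma deg_less_cong: "deg_less d n f \<Longrightarrow> (\<And>i. i \<in> {1..d} \<Longrightarrow> x i = y i) \<Longrightarrow> f x = f y"
  by (induction rule: deg_less.induct) auto

text \<open>
  The basis \<open>(c - |x|)\<^sub>k\<close> with \<open>c = r + |l|\<close> is, as a function of the last coordinate, the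
  one in which the moments of the last Hahn polynomial are known. The sum over that coordinate is
  zero if \<open>k < n = \<nu>\<^bsub>d+1\<^esub>\<close>, and otherwise it lowers the degree by \<open>n\<close>.
\<close>
theorem phi_poly_orthogonal_lower_degree:
  assumes "pochhammer r (total d l) \<noteq> 0"
    and "\<And>i. i \<in> {1..d} \<Longrightarrow> \<nu> i \<le> l i" and "deg_less d (total d \<nu>) p"
  shows "(\<Sum>x\<in>V d l. phi_poly d \<beta> r l \<nu> (real \<circ> x) * p (real \<circ> x) * weight d \<beta> r l x) = 0"
  using assms
proof (induction d arbitrary: \<beta> r p)
  case 0
  then show ?case by (simp add: total_def deg_less_0)
next
  case (Suc d)
  define n where "n = \<nu> (Suc d)"
  let ?L = "total d l" and ?N = "l (Suc d)"
  let ?a = "\<lambda>x. \<beta> + 1 + real (total d x)" and ?b = "\<lambda>x. r + real ?L - real (total d x)"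
  let ?p = "\<lambda>x. phi_poly d (\<beta> + real n) (r + real n) l \<nu> (real \<circ> x)"
  have n: "n \<le> ?N" using Suc.prems(2) by (auto simp: n_def)
  have nzL: "pochhammer r (?L + n) \<noteq> 0"
    using pochhammer_neq_0_mono[OF Suc.prems(1), of "?L + n"] n by (simp add: total_Suc)
  have nzn: "pochhammer (r + real n) ?L \<noteq> 0"
    using pochhammer_add_nonzero(2)[of r n ?L] nzL by (simp add: add.commute)
  let ?c = "r + real ?L + real ?N"
  have base: "(\<Sum>x\<in>V (Suc d) l. phi_poly (Suc d) \<beta> r l \<nu> (real \<circ> x) * weight (Suc d) \<beta> r l x *
        (q (real \<circ> x) * pochhammer (?c - total (Suc d) (real \<circ> x)) k)) = 0"
    if q: "deg_less d m q" and mk: "m + k \<le> total (Suc d) \<nu>" for m q k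
  proof -
    let ?e = "pochhammer (real k + 1 - real n) n *
      pochhammer (\<beta> + r + 1 + real ?L + real k + real n) (?N - n)"
    have inner: "(\<Sum>y\<le>?N. real (?N choose y) * pochhammer (?a x) y * pochhammer (?b x) (?N - y) *
        (phi_poly (Suc d) \<beta> r l \<nu> (real \<circ> x(Suc d := y)) *
          (q (real \<circ> x(Suc d := y)) * pochhammer (?c - total (Suc d) (real \<circ> x(Suc d := y))) k)))
      = ?p x * q (real \<circ> x) * (pochhammer (?a x) n * pochhammer (?b x) k * ?e)" for x
    proof -
      have q': "q (real \<circ> x(Suc d := y)) = q (real \<circ> x)" for y
        by (rule deg_less_cong[OF q]) auto
      have c: "?c - total (Suc d) (real \<circ> x(Suc d := y)) = ?b x + real ?N - real y" for y
        by (simp only: total_of_nat total_Suc total_update_Suc) simp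
      have s: "?a x + ?b x + real k + real n = \<beta> + r + 1 + real ?L + real k + real n" by simp
      have "(\<Sum>y\<le>?N. real (?N choose y) * pochhammer (?a x) y * pochhammer (?b x) (?N - y) *
        (phi_poly (Suc d) \<beta> r l \<nu> (real \<circ> x(Suc d := y)) *
          (q (real \<circ> x(Suc d := y)) * pochhammer (?c - total (Suc d) (real \<circ> x(Suc d := y))) k)))
        = ?p x * q (real \<circ> x) *
          (\<Sum>y\<le>?N. real (?N choose y) * pochhammer (?a x) y * pochhammer (?b x) (?N - y) *
            (hahn_poly n ?N (?a x) (real n + ?a x + ?b x - 1) (real y) *
             pochhammer (?b x + real ?N - real y) k))"
        unfolding sum_distrib_left phi_poly_Suc n_def[symmetric] q' c
        by (intro sum.cong refl) (simp only: mult_ac)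
      also have "\<dots> = ?p x * q (real \<circ> x) * (pochhammer (?a x) n * pochhammer (?b x) k * ?e)"
        unfolding hahn_poly_moment[OF n] s by (simp only: mult_ac)
      finally show ?thesis .
    qed
    have "(\<Sum>x\<in>V (Suc d) l. phi_poly (Suc d) \<beta> r l \<nu> (real \<circ> x) * weight (Suc d) \<beta> r l x *
        (q (real \<circ> x) * pochhammer (?c - total (Suc d) (real \<circ> x)) k))
      = (\<Sum>x\<in>V (Suc d) l. (phi_poly (Suc d) \<beta> r l \<nu> (real \<circ> x) *
        (q (real \<circ> x) * pochhammer (?c - total (Suc d) (real \<circ> x)) k)) * weight (Suc d) \<beta> r l x)"
      by (intro sum.cong refl) (simp only: mult_ac)
    also have "\<dots> = (\<Sum>x\<in>V d l. weight d \<beta> r l x / pochhammer (r + real ?L) ?N *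
        (?p x * q (real \<circ> x) * (pochhammer (?a x) n * pochhammer (?b x) k * ?e)))"
      unfolding sum_weight_Suc[OF Suc.prems(1)] inner ..
    also have "\<dots> = 0"
    proof (cases "k < n")
      case True
      then show ?thesis by (simp add: pochhammer_neg_gap_zero)
    next
      case False
      let ?q = "\<lambda>x. q x * pochhammer (r + real n + real ?L + - 1 * (\<Sum>i\<in>{1..d}. x i)) (k - n)"
      have "deg_less d (m + (k - n)) ?q"
        by (rule deg_less_pochhammer[OF q]) simp
      moreover have "m + (k - n) \<le> total d \<nu>"
        using mk False by (simp add: total_Suc n_def)
      ultimately have deg: "deg_less d (total d \<nu>) ?q"
        by (rule deg_less_mono)
      have "pochhammer (?b x) k = pochhammer (?b x) n * pochhammer (?b x + real n) (k - n)" for x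
        using False by (intro pochhammer_product) simp
      moreover have "?q (real \<circ> x) = q (real \<circ> x) * pochhammer (?b x + real n) (k - n)" for x
      proof -
        have "(\<Sum>i\<in>{1..d}. (real \<circ> x) i) = real (total d x)"
          using total_of_nat[of d x] by (simp only: total_def)
        then have "r + real n + real ?L + - 1 * (\<Sum>i\<in>{1..d}. (real \<circ> x) i) = ?b x + real n"
          by (simp only:)
        then show ?thesis by (simp only:)
      qed
      ultimately have "(\<Sum>x\<in>V d l. weight d \<beta> r l x / pochhammer (r + real ?L) ?N *
          (?p x * q (real \<circ> x) * (pochhammer (?a x) n * pochhammer (?b x) k * ?e)))
        = (\<Sum>x\<in>V d l. ?e / pochhammer (r + real ?L) ?N * (?p x * ?q (real \<circ> x)) *
          (weight d \<beta> r l x * (pochhammer (?a x) n * pochhammer (?b x) n)))"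
        by (intro sum.cong refl) (simp only: times_divide_eq_left times_divide_eq_right mult_ac)
      also have "\<dots> = ?e / pochhammer (r + real ?L) ?N *
          (pochhammer (\<beta> + 1) n * pochhammer (r + real ?L) n) *
          (\<Sum>x\<in>V d l. ?p x * ?q (real \<circ> x) * weight d (\<beta> + real n) (r + real n) l x)"
        unfolding sum_distrib_left weight_shift[OF nzL]
        by (intro sum.cong refl) (simp only: weight_shift[OF nzL] mult_ac)
      also have "(\<Sum>x\<in>V d l. ?p x * ?q (real \<circ> x) * weight d (\<beta> + real n) (r + real n) l x) = 0"
        using Suc.prems(2) by (intro Suc.IH nzn deg) auto
      finally show ?thesis by (simp only: mult_zero_right)
    qed
    finally show ?thesis .
  qed
  have "(\<Sum>x\<in>V (Suc d) l. phi_poly (Suc d) \<beta> r l \<nu> (real \<circ> x) * weight (Suc d) \<beta> r l x * p (real \<circ> x)) = 0"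
    by (rule weighted_sum_zero_last_variable[OF Suc.prems(3) base])
  then show ?case by (simp add: mult_ac o_def)
qed


section \<open>The difference operator on polynomials\<close>

text \<open>
  The product \<open>\<Prod>\<^sub>i (-x\<^sub>i)\<^bsub>k i\<^esub>\<close>, up to sign a product of falling factorials. These
  polynomials are eigenfunctions of all \<open>x\<^sub>i \<nabla>\<^sub>i\<close>, and \<open>D\<close> is triangular in the basis
  that they form.
\<close>
definition factorial_monomial :: "nat \<Rightarrow> (nat \<Rightarrow> nat) \<Rightarrow> (nat \<Rightarrow> real) \<Rightarrow> real" where
  "factorial_monomial d k x = (\<Prod>i=1..d. pochhammer (- x i) (k i))"

lemma factorial_monomial_split:
  assumes "i \<in> {1..d}"
  shows "factorial_monomial d (k(i := m)) (x(i := t)) =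
    pochhammer (- t) m * (\<Prod>j\<in>{1..d} - {i}. pochhammer (- x j) (k j))"
proof -
  have "(\<Prod>j\<in>{1..d} - {i}. pochhammer (- (x(i := t)) j) ((k(i := m)) j))
      = (\<Prod>j\<in>{1..d} - {i}. pochhammer (- x j) (k j))"
    by (intro prod.cong) auto
  then show ?thesis
    using assms unfolding factorial_monomial_def by (subst prod.remove[of _ i]) auto
qed

lemma pochhammer_neg_fdiff:
  "pochhammer (- (x + 1)) m - pochhammer (- x) m = - real m * pochhammer (- x :: real) (m - 1)"
proof (cases m)
  case (Suc n)
  have "pochhammer (- (x + 1)) (Suc n) = (- x - 1) * pochhammer (- x) n"
    using pochhammer_rec[of "- (x + 1)" n] by simp
  then show ?thesis by (simp add: Suc pochhammer_Suc algebra_simps)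
qed simp

lemma pochhammer_neg_bdiff:
  "x * (pochhammer (- x) m - pochhammer (- (x - 1)) m) = real m * pochhammer (- x :: real) m"
proof (cases m)
  case (Suc n)
  have "pochhammer (- x) (Suc n) = - x * pochhammer (- (x - 1)) n"
    using pochhammer_rec[of "- x" n] by (simp add: add.commute)
  then show ?thesis using pochhammer_neg_fdiff[of "x - 1" m] by (simp add: Suc algebra_simps)
qed simp

lemma fdiff_factorial_monomial:
  assumes "i \<in> {1..d}"
  shows "fdiff i (factorial_monomial d k) x = - real (k i) * factorial_monomial d (k(i := k i - 1)) x"
  using factorial_monomial_split[OF assms, of k "k i" x "x i + 1"]
    factorial_monomial_split[OF assms, of k "k i" x "x i"]
    factorial_monomial_split[OF assms, of k "k i - 1" x "x i"]
    pochhammer_neg_fdiff[of "x i" "k i"]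
  by (simp add: fdiff_def left_diff_distrib[symmetric])

lemma coord_bdiff_factorial_monomial:
  assumes "i \<in> {1..d}"
  shows "x i * bdiff i (factorial_monomial d k) x = real (k i) * factorial_monomial d k x"
  using factorial_monomial_split[OF assms, of k "k i" x "x i - 1"]
    factorial_monomial_split[OF assms, of k "k i" x "x i"]
    pochhammer_neg_bdiff[of "x i" "k i"]
  by (simp add: bdiff_def left_diff_distrib[symmetric] mult.assoc[symmetric])

lemma coord_factorial_monomial:
  assumes "i \<in> {1..d}"
  shows "x i * factorial_monomial d k x =
    real (k i) * factorial_monomial d k x - factorial_monomial d (k(i := k i + 1)) x"
  using factorial_monomial_split[OF assms, of k "k i" x "x i"]
    factorial_monomial_split[OF assms, of k "k i + 1" x "x i"]
  by (simp add: pochhammer_Suc algebra_simps)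

lemma coord_fdiff_factorial_monomial:
  assumes "i \<in> {1..d}"
  shows "x i * fdiff i (factorial_monomial d k) x =
    real (k i) * factorial_monomial d k x + (real (k i) - 1) * fdiff i (factorial_monomial d k) x"
proof (cases "k i")
  case 0
  then show ?thesis by (simp add: fdiff_factorial_monomial[OF assms])
next
  case (Suc n)
  have e: "factorial_monomial d k x =
      real n * factorial_monomial d (k(i := n)) x - x i * factorial_monomial d (k(i := n)) x"
    using coord_factorial_monomial[OF assms, of x "k(i := n)"] Suc by (simp add: fun_upd_idem)
  show ?thesis
    unfolding fdiff_factorial_monomial[OF assms] e Suc by (simp add: algebra_simps)
qed

lemma coord_fdiff_bdiff_factorial_monomial:
  assumes j: "j \<in> {1..d}"
  shows "x j * fdiff i (bdiff j (factorial_monomial d k)) x =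
    (real (k j) - (if i = j then 1 else 0)) * fdiff i (factorial_monomial d k) x"
proof -
  let ?f = "factorial_monomial d k" and ?y = "x(i := x i + 1)"
  have 1: "x j * bdiff j ?f x = real (k j) * ?f x" and 2: "?y j * bdiff j ?f ?y = real (k j) * ?f ?y"
    by (rule coord_bdiff_factorial_monomial[OF j])+
  show ?thesis
  proof (cases "i = j")
    case True
    then have "bdiff j ?f ?y = fdiff i ?f x" by (simp add: bdiff_def fdiff_def)
    then show ?thesis using 1 2 True by (simp add: fdiff_def[of _ "bdiff j ?f"]) (simp add: fdiff_def algebra_simps)
  next
    case False
    then show ?thesis using 1 2 by (simp add: fdiff_def algebra_simps)
  qed
qed

lemma diffop_factorial_monomial:
  "diffop d \<beta> r l (factorial_monomial d k) x =
    eigval \<beta> r (total d k) * factorial_monomial d k x +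
    (\<Sum>i=1..d. (real (total d k) + \<beta>) * (real (l i) - real (k i) + 1) * fdiff i (factorial_monomial d k) x)"
proof -
  let ?f = "factorial_monomial d k" and ?K = "real (total d k)"
  have inner: "(\<Sum>j=1..d. x j * (x i - real (l i) - (if i = j then 1 else 0) * r) * fdiff i (bdiff j ?f) x)
      = ((?K - 1) * (x i - real (l i)) - r * (real (k i) - 1)) * fdiff i ?f x" if i: "i \<in> {1..d}" for i
  proof -
    have "(\<Sum>j=1..d. x j * (x i - real (l i) - (if i = j then 1 else 0) * r) * fdiff i (bdiff j ?f) x)
      = (\<Sum>j=1..d. ((x i - real (l i)) * real (k j) -
          (if i = j then x i - real (l i) + r * (real (k i) - 1) else 0)) * fdiff i ?f x)"
    proof (intro sum.cong refl)
      fix j assume j: "j \<in> {1..d}"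
      have "x j * c * fdiff i (bdiff j ?f) x = c * ((real (k j) - (if i = j then 1 else 0)) * fdiff i ?f x)" for c
        unfolding coord_fdiff_bdiff_factorial_monomial[OF j, symmetric] by simp
      then show "x j * (x i - real (l i) - (if i = j then 1 else 0) * r) * fdiff i (bdiff j ?f) x =
          ((x i - real (l i)) * real (k j) -
            (if i = j then x i - real (l i) + r * (real (k i) - 1) else 0)) * fdiff i ?f x"
        by (simp only:) (simp add: algebra_simps)
    qed
    also have "\<dots> = ((x i - real (l i)) * ?K - (x i - real (l i) + r * (real (k i) - 1))) * fdiff i ?f x"
      using i by (simp add: sum_distrib_right[symmetric] sum_subtractf sum_distrib_left[symmetric]
          total_def)
    finally show ?thesis by (simp add: algebra_simps)
  qed
  have "diffop d \<beta> r l ?f x =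
      - (\<Sum>i=1..d. ((?K - 1) * (x i - real (l i)) - r * (real (k i) - 1)) * fdiff i ?f x) +
      (\<Sum>i=1..d. (- (\<beta> + r + 1) * x i + real (l i) * (\<beta> + 1)) * fdiff i ?f x)"
    unfolding diffop_def
    by (intro arg_cong2[where f = "(+)"] arg_cong[where f = uminus] sum.cong refl inner)
  also have "\<dots> = (\<Sum>i=1..d. - (?K + \<beta> + r) * (x i * fdiff i ?f x) +
      (real (l i) * (?K + \<beta>) + r * (real (k i) - 1)) * fdiff i ?f x)"
    unfolding sum_negf[symmetric] sum.distrib[symmetric]
    by (intro sum.cong refl) (simp add: algebra_simps)
  also have "\<dots> = (\<Sum>i=1..d. - (?K + \<beta> + r) * (real (k i) * ?f x) +
      (?K + \<beta>) * (real (l i) - real (k i) + 1) * fdiff i ?f x)"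
    by (intro sum.cong refl) (simp only: coord_fdiff_factorial_monomial, simp add: algebra_simps)
  also have "\<dots> = - (?K + \<beta> + r) * ((\<Sum>i=1..d. real (k i)) * ?f x) +
      (\<Sum>i=1..d. (?K + \<beta>) * (real (l i) - real (k i) + 1) * fdiff i ?f x)"
    by (simp only: sum.distrib sum_distrib_left sum_distrib_right)
  finally show ?thesis
    by (simp add: eigval_def total_def algebra_simps)
qed

lemma deg_less_factorial_monomial: "deg_less d (Suc (total d k)) (factorial_monomial d k)"
proof -
  have "deg_less d (Suc (\<Sum>i=1..m. k i)) (\<lambda>x. \<Prod>i=1..m. pochhammer (- x i) (k i))" if "m \<le> d" for m
    using that
  proof (induction m)
    case 0
    show ?case using deg_less.const[of d 0 1] by simp
  next
    case (Suc m)
    then show ?case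
      using deg_less_pochhammer[of d "Suc (\<Sum>i=1..m. k i)" _ "{Suc m}" "k (Suc m)" 0 "- 1"] by simp
  qed
  from this[of d] show ?thesis
    unfolding factorial_monomial_def total_def by simp
qed

lemma total_update:
  assumes "i \<in> {1..d}"
  shows "total d (k(i := m)) + k i = total d k + (m :: nat)"
proof -
  have "(\<Sum>j\<in>{1..d} - {i}. (k(i := m)) j) = (\<Sum>j\<in>{1..d} - {i}. k j)"
    by (intro sum.cong) auto
  then show ?thesis
    using sum.remove[of "{1..d}" i "k(i := m)"] sum.remove[of "{1..d}" i k] assms
    unfolding total_def by simp
qed

lemma deg_less_fdiff_factorial_monomial:
  assumes "i \<in> {1..d}"
  shows "deg_less d (total d k) (fdiff i (factorial_monomial d k))"
proof -
  have e: "fdiff i (factorial_monomial d k) =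
      (\<lambda>x. - real (k i) * factorial_monomial d (k(i := k i - 1)) x)"
    using fdiff_factorial_monomial[OF assms] by blast
  show ?thesis
  proof (cases "k i = 0")
    case True
    then show ?thesis unfolding e using deg_less.zero by simp
  next
    case False
    then have "total d k = Suc (total d (k(i := k i - 1)))"
      using total_update[OF assms, of k "k i - 1"] by simp
    then show ?thesis unfolding e by (simp only: deg_less_scale deg_less_factorial_monomial)
  qed
qed

text \<open>
  Every polynomial of degree less than \<open>n\<close> is a linear combination of factorial monomials of degree
  less than \<open>n\<close>.
\<close>
lemma deg_less_factorial_induct [consumes 1, case_names zero monomial add]:
  assumes f: "deg_less d n f"
    and zero: "Z (\<lambda>_. 0)"
    and monomial: "\<And>c k. total d k < n \<Longrightarrow> Z (\<lambda>x. c * factorial_monomial d k x)"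
    and add: "\<And>f g. Z f \<Longrightarrow> Z g \<Longrightarrow> Z (\<lambda>x. f x + g x)"
  shows "Z f"
proof -
  (* coordinates are moved from f into the factorial monomial, starting with the monomial 1 *)
  have "Z (\<lambda>x. f x * (c * factorial_monomial d k x))"
    if "deg_less d m f" "m + total d k \<le> n" for m f c k
    using that
  proof (induction arbitrary: c k rule: deg_less.induct)
    case (zero m)
    then show ?case using assms(2) by simp
  next
    case (const m e)
    then show ?case using monomial[of k "e * c"] by (simp add: mult.assoc)
  next
    case (coord i m f)
    have e: "x i * f x * (c * factorial_monomial d k x) =
        f x * ((c * real (k i)) * factorial_monomial d k x) +
        f x * (- c * factorial_monomial d (k(i := k i + 1)) x)" for x
    proof -
      have "x i * f x * (c * factorial_monomial d k x) = f x * (c * (x i * factorial_monomial d k x))"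
        by simp
      then show ?thesis
        unfolding coord_factorial_monomial[OF coord.hyps(1)] by (simp add: algebra_simps)
    qed
    have "m + total d k \<le> n" "m + total d (k(i := k i + 1)) \<le> n"
      using total_update[OF coord.hyps(1), of k "k i + 1"] coord.prems by simp_all
    then show ?case
      unfolding e by (intro add coord.IH)
  next
    case (add m f g)
    then show ?case using assms(4)[OF add.IH(1)[of k c] add.IH(2)[of k c]] by (simp add: distrib_right)
  qed
  from this[OF f, of "\<lambda>_. 0" 1] show ?thesis
    by (simp add: factorial_monomial_def total_def)
qed

lemma diffop_add: "diffop d \<beta> r l (\<lambda>x. f x + g x) x = diffop d \<beta> r l f x + diffop d \<beta> r l g x"
proof -
  have 1: "fdiff i (\<lambda>x. f x + g x) x = fdiff i f x + fdiff i g x"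
    and 2: "fdiff i (bdiff j (\<lambda>x. f x + g x)) x = fdiff i (bdiff j f) x + fdiff i (bdiff j g) x" for i j
    by (simp_all add: fdiff_def bdiff_def)
  show ?thesis unfolding diffop_def 1 2 distrib_left sum.distrib by simp
qed

lemma diffop_scale: "diffop d \<beta> r l (\<lambda>x. c * f x) x = c * diffop d \<beta> r l f x"
proof -
  have 1: "fdiff i (\<lambda>x. c * f x) x = c * fdiff i f x"
    and 2: "fdiff i (bdiff j (\<lambda>x. c * f x)) x = c * fdiff i (bdiff j f) x" for i j
    by (simp_all add: fdiff_def bdiff_def algebra_simps)
  show ?thesis unfolding diffop_def 1 2 by (simp add: sum_distrib_left algebra_simps)
qed

lemma diffop_zero: "diffop d \<beta> r l (\<lambda>_. 0) x = 0"
  using diffop_scale[of d \<beta> r l 0 "\<lambda>_. 0" x] by simp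

lemma diffop_leading_term:
  assumes "deg_less d (Suc n) f"
  obtains g where "deg_less d n g" "\<And>x. diffop d \<beta> r l f x = eigval \<beta> r n * f x + g x"
proof -
  from assms have "\<exists>g. deg_less d n g \<and> (\<forall>x. diffop d \<beta> r l f x = eigval \<beta> r n * f x + g x)"
  proof (induction rule: deg_less_factorial_induct)
    case zero
    show ?case by (intro exI[of _ "\<lambda>_. 0"]) (simp add: diffop_zero deg_less.zero)
  next
    case (monomial c k)
    let ?f = "factorial_monomial d k" and ?K = "total d k"
    define h where "h = (\<lambda>x. \<Sum>i=1..d. (real ?K + \<beta>) * (real (l i) - real (k i) + 1) * fdiff i ?f x)"
    have h: "deg_less d n h"
    proof (rule deg_less_mono)
      show "deg_less d ?K h"
        unfolding h_def by (intro deg_less_sum deg_less_scale deg_less_fdiff_factorial_monomial) auto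
    qed (use monomial in simp)
    have "deg_less d n (\<lambda>x. c * (eigval \<beta> r ?K - eigval \<beta> r n) * ?f x)"
    proof (cases "?K = n")
      case True
      then show ?thesis using deg_less.zero by simp
    next
      case False
      then show ?thesis
        using monomial deg_less_mono[OF deg_less_factorial_monomial, of d k n]
        by (intro deg_less_scale) simp
    qed
    from deg_less.add[OF this deg_less_scale[OF h, of c]]
    show ?case
      by (intro exI[of _ "\<lambda>x. c * (eigval \<beta> r ?K - eigval \<beta> r n) * ?f x + c * h x"])
        (simp add: diffop_scale diffop_factorial_monomial h_def algebra_simps)
  next
    case (add f g)
    then obtain f' g' where "deg_less d n f'" "deg_less d n g'"
      "\<And>x. diffop d \<beta> r l f x = eigval \<beta> r n * f x + f' x"
      "\<And>x. diffop d \<beta> r l g x = eigval \<beta> r n * g x + g' x" by blast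
    then show ?case
      by (intro exI[of _ "\<lambda>x. f' x + g' x"]) (auto simp: diffop_add algebra_simps intro: deg_less.add)
  qed
  then show ?thesis using that by blast
qed

lemma deg_less_diffop:
  assumes "deg_less d n f"
  shows "deg_less d n (diffop d \<beta> r l f)"
proof (cases n)
  case 0
  with assms have "f = (\<lambda>_. 0)" using deg_less_0 by blast
  then have "diffop d \<beta> r l f = (\<lambda>_. 0)" by (auto simp: diffop_zero)
  then show ?thesis using deg_less.zero by simp
next
  case (Suc m)
  with assms obtain g where g: "deg_less d m g" "\<And>x. diffop d \<beta> r l f x = eigval \<beta> r m * f x + g x"
    using diffop_leading_term by blast
  then have "diffop d \<beta> r l f = (\<lambda>x. eigval \<beta> r m * f x + g x)" by blast
  then show ?thesis
    using deg_less.add[OF deg_less_scale[OF assms, of "eigval \<beta> r m"], of g] deg_less_Suc[OF g(1)] Suc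
    by simp
qed

section \<open>Self-adjointness of the difference operator\<close>

text \<open>
  The operator as a combination of the shifts by \<open>e\<^sub>i\<close>, \<open>-e\<^sub>i\<close> and \<open>e\<^sub>i - e\<^sub>j\<close>.
\<close>
lemma diffop_expand:
  fixes x :: "nat \<Rightarrow> real"
  shows "diffop d \<beta> r l f x =
    (\<Sum>i=1..d. (real (l i) - x i) * (total d x + \<beta> + 1) * (f (x(i := x i + 1)) - f x)) +
    (\<Sum>i=1..d. x i * (real (total d l) - total d x + r) * (f (x(i := x i - 1)) - f x)) -
    (\<Sum>i=1..d. \<Sum>j=1..d. if i = j then 0
       else x j * (real (l i) - x i) * (f (x(i := x i + 1, j := x j - 1)) - f x))"
proof -
  define U where "U i = f (x(i := x i + 1)) - f x" for i
  define D where "D i = f (x(i := x i - 1)) - f x" for i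
  define E where "E i j = (if i = j then 0
       else x j * (real (l i) - x i) * (f (x(i := x i + 1, j := x j - 1)) - f x))" for i j
  have T: "x j * (x i - real (l i) - (if i = j then 1 else 0) * r) * fdiff i (bdiff j f) x =
      E i j - x j * ((real (l i) - x i) * U i) - (real (l i) - x i) * (x j * D j)
      - (if i = j then r * x i * (U i + D i) else 0)" for i j
    by (auto simp: fdiff_def bdiff_def U_def D_def E_def algebra_simps)
  have 1: "(\<Sum>i=1..d. \<Sum>j=1..d. x j * ((real (l i) - x i) * U i)) =
      (\<Sum>i=1..d. total d x * ((real (l i) - x i) * U i))"
    unfolding total_def sum_distrib_right ..
  have 2: "(\<Sum>i=1..d. \<Sum>j=1..d. (real (l i) - x i) * (x j * D j)) =
      (\<Sum>j=1..d. (real (total d l) - total d x) * (x j * D j))"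
    by (subst sum.swap) (simp add: total_def sum_distrib_right[symmetric] sum_subtractf)
  have 3: "(\<Sum>i=1..d. \<Sum>j=1..d. if i = j then r * x i * (U i + D i) else 0) =
      (\<Sum>i=1..d. r * x i * (U i + D i))"
    by (intro sum.cong refl) simp
  have F: "fdiff i f x = U i" for i by (simp add: fdiff_def U_def)
  have "diffop d \<beta> r l f x = (\<Sum>i=1..d. total d x * ((real (l i) - x i) * U i)) +
      (\<Sum>j=1..d. (real (total d l) - total d x) * (x j * D j)) +
      (\<Sum>i=1..d. r * x i * (U i + D i)) +
      (\<Sum>i=1..d. (- (\<beta> + r + 1) * x i + real (l i) * (\<beta> + 1)) * U i) -
      (\<Sum>i=1..d. \<Sum>j=1..d. E i j)"
    unfolding diffop_def T F sum_subtractf 1 2 3 by simp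
  also have "\<dots> = (\<Sum>i=1..d. (real (l i) - x i) * (total d x + \<beta> + 1) * U i) +
    (\<Sum>i=1..d. x i * (real (total d l) - total d x + r) * D i) - (\<Sum>i=1..d. \<Sum>j=1..d. E i j)"
    unfolding sum.distrib[symmetric]
    by (intro arg_cong2[where f = "(-)"] sum.cong refl) (simp add: algebra_simps)
  finally show ?thesis unfolding U_def D_def E_def .
qed

lemma V_update: "x \<in> V d l \<Longrightarrow> i \<in> {1..d} \<Longrightarrow> c \<le> l i \<Longrightarrow> x(i := c) \<in> V d l"
  by (auto simp: V_def PiE_def Pi_def extensional_def)

text \<open>
  Detailed balance: the weight times the coefficient of the shift \<open>x \<mapsto> x + e\<^sub>i\<close> is the weight at
  \<open>x + e\<^sub>i\<close> times the coefficient there of the inverse shift.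
\<close>
lemma weight_balance:
  assumes nz: "pochhammer r (total d l) \<noteq> 0"
    and x: "x \<in> V d l" and i: "i \<in> {1..d}" and xi: "x i < l i"
  shows "weight d \<beta> r l x * ((real (l i) - real (x i)) * (real (total d x) + \<beta> + 1)) =
    weight d \<beta> r l (x(i := x i + 1)) *
      ((real (x i) + 1) * (real (total d l) - (real (total d x) + 1) + r))"
proof -
  let ?y = "x(i := x i + 1)" and ?X = "total d x" and ?L = "total d l"
  let ?P = "\<Prod>j\<in>{1..d} - {i}. real (l j choose x j)"
  have y: "?y \<in> V d l" using V_update[OF x i, of "x i + 1"] xi by simp
  have ty: "total d ?y = Suc ?X" using total_update[OF i, of x "x i + 1"] by simp
  have lt: "Suc ?X \<le> ?L" using V_total_le[OF y] ty by simp
  have P1: "(\<Prod>j=1..d. real (l j choose x j)) = real (l i choose x i) * ?P"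
    using i by (simp add: prod.remove)
  have "(\<Prod>j\<in>{1..d} - {i}. real (l j choose ?y j)) = ?P" by (intro prod.cong) auto
  then have P2: "(\<Prod>j=1..d. real (l j choose ?y j)) = real (l i choose Suc (x i)) * ?P"
    using prod.remove[of "{1..d}" i "\<lambda>j. real (l j choose ?y j)"] i by simp
  have "Suc (x i) * (l i choose Suc (x i)) = (l i - x i) * (l i choose x i)"
    using binomial_absorption[of "x i" "l i"] binomial_absorb_comp[of "l i" "x i"] by simp
  then have "real (Suc (x i) * (l i choose Suc (x i))) = real ((l i - x i) * (l i choose x i))"
    by (rule arg_cong)
  then have bin: "real (l i choose Suc (x i)) * (real (x i) + 1) = real (l i choose x i) * (real (l i) - real (x i))"
    using xi by (simp add: of_nat_diff algebra_simps)
  have pa: "pochhammer (\<beta> + 1) (Suc ?X) = pochhammer (\<beta> + 1) ?X * (real ?X + \<beta> + 1)"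
    by (simp add: pochhammer_Suc add_ac)
  have "?L - ?X = Suc (?L - Suc ?X)" using lt by simp
  then have pr: "pochhammer r (?L - ?X) =
      pochhammer r (?L - Suc ?X) * (real ?L - (real ?X + 1) + r)"
    using lt by (simp only: pochhammer_Suc) (simp add: of_nat_diff algebra_simps)
  have "weight d \<beta> r l x * ((real (l i) - real (x i)) * (real ?X + \<beta> + 1)) =
      (real (l i choose x i) * (real (l i) - real (x i))) * ?P *
      (pochhammer (\<beta> + 1) ?X * (real ?X + \<beta> + 1)) * pochhammer r (?L - ?X) / pochhammer r ?L"
    unfolding weight_eq[OF nz x] P1 by simp
  also have "\<dots> = weight d \<beta> r l ?y * ((real (x i) + 1) * (real ?L - (real ?X + 1) + r))"
    unfolding weight_eq[OF nz y] P2 ty pr pa bin[symmetric] by simp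
  finally show ?thesis .
qed

text \<open>
  Detailed balance for \<open>x \<mapsto> x + e\<^sub>i - e\<^sub>j\<close>. The points \<open>x\<close> and \<open>x + e\<^sub>i - e\<^sub>j\<close> are both upper
  neighbours of \<open>z = x - e\<^sub>j\<close>, and the balances at \<open>z\<close> are compared.
\<close>
lemma weight_balance_exchange:
  assumes nz: "pochhammer r (total d l) \<noteq> 0"
    and x: "x \<in> V d l" and i: "i \<in> {1..d}" and j: "j \<in> {1..d}" and ij: "i \<noteq> j"
    and xi: "x i < l i" and xj: "0 < x j"
  shows "weight d \<beta> r l x * (real (x j) * (real (l i) - real (x i))) =
    weight d \<beta> r l (x(i := x i + 1, j := x j - 1)) *
      ((real (x i) + 1) * (real (l j) - (real (x j) - 1)))"
proof -
  define z where "z = x(j := x j - 1)"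
  let ?Z = "real (total d z)" and ?L = "real (total d l)"
  have xjl: "x j \<le> l j" using V_le[OF x j] .
  have z: "z \<in> V d l" unfolding z_def by (rule V_update[OF x j]) (use xjl in simp)
  have zx: "z(j := z j + 1) = x" using xj by (auto simp: z_def)
  have zy: "z(i := z i + 1) = x(i := x i + 1, j := x j - 1)" using ij by (auto simp: z_def)
  have zi: "z i = x i" using ij by (simp add: z_def)
  have zj: "real (z j) = real (x j) - 1" using xj by (simp add: z_def of_nat_diff)
  have 1: "weight d \<beta> r l z * ((real (l j) - (real (x j) - 1)) * (?Z + \<beta> + 1)) =
      weight d \<beta> r l x * (real (x j) * (?L - (?Z + 1) + r))"
    using weight_balance[OF nz z j, of \<beta>] xj xjl unfolding zx zj by (simp add: z_def)
  have 2: "weight d \<beta> r l z * ((real (l i) - real (x i)) * (?Z + \<beta> + 1)) =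
      weight d \<beta> r l (x(i := x i + 1, j := x j - 1)) * ((real (x i) + 1) * (?L - (?Z + 1) + r))"
    using weight_balance[OF nz z i, of \<beta>, unfolded zy] xi by (simp add: zi)
  have "Suc (total d z) = total d x"
    using total_update[OF j, of z "z j + 1"] unfolding zx by simp
  then have "total d z < total d l" using V_total_le[OF x] by simp
  then have "?L - (?Z + 1) + r \<noteq> 0"
    using nz by (auto simp: pochhammer_eq_0_iff of_nat_diff dest: spec[of _ "total d l - Suc (total d z)"])
  moreover have "weight d \<beta> r l x * (real (x j) * (real (l i) - real (x i))) * (?L - (?Z + 1) + r) =
      weight d \<beta> r l (x(i := x i + 1, j := x j - 1)) *
      ((real (x i) + 1) * (real (l j) - (real (x j) - 1))) * (?L - (?Z + 1) + r)"
    using 1 2 by algebra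
  ultimately show ?thesis by simp
qed

text \<open>
  The coefficients vanish where a shift leaves the lattice, so summing the balance over all points
  gives the adjoints of the shifts. In the terms with coefficient zero the truncated subtraction
  \<open>x i - 1\<close> and the points outside the lattice do no harm.
\<close>
lemma sum_weight_shift:
  assumes nz: "pochhammer r (total d l) \<noteq> 0" and i: "i \<in> {1..d}"
  shows "(\<Sum>x\<in>V d l. weight d \<beta> r l x * ((real (l i) - real (x i)) * (real (total d x) + \<beta> + 1)) *
      (F (x(i := x i + 1)) * G x)) =
    (\<Sum>x\<in>V d l. weight d \<beta> r l x * (real (x i) * (real (total d l) - real (total d x) + r)) *
      (F x * G (x(i := x i - 1))))"
proof (rule sum_reindex_support[where P = "\<lambda>x. x i < l i" and Q = "\<lambda>y. 0 < y i"
      and j = "\<lambda>x. x(i := x i + 1)" and i = "\<lambda>y. y(i := y i - 1)"])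
  fix x assume x: "x \<in> V d l" "x i < l i"
  have "total d (x(i := x i + 1)) = total d x + 1"
    using total_update[OF i, of x "x i + 1"] by simp
  then show "(x(i := x i + 1))(i := (x(i := x i + 1)) i - 1) = x \<and>
      x(i := x i + 1) \<in> V d l \<and> 0 < (x(i := x i + 1)) i \<and>
      weight d \<beta> r l (x(i := x i + 1)) * (real ((x(i := x i + 1)) i) *
        (real (total d l) - real (total d (x(i := x i + 1))) + r)) *
      (F (x(i := x i + 1)) * G ((x(i := x i + 1))(i := (x(i := x i + 1)) i - 1))) =
      weight d \<beta> r l x * ((real (l i) - real (x i)) * (real (total d x) + \<beta> + 1)) *
      (F (x(i := x i + 1)) * G x)"
    unfolding weight_balance[OF nz x(1) i x(2)]
    using V_update[OF x(1) i, of "x i + 1"] x(2) by (simp add: add.commute)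
next
  fix y assume y: "y \<in> V d l" "0 < y i"
  have yl: "y i \<le> l i" using V_le[OF y(1) i] .
  then have "y(i := y i - 1) \<in> V d l" by (intro V_update[OF y(1) i]) simp
  then show "(y(i := y i - 1))(i := (y(i := y i - 1)) i + 1) = y \<and>
      y(i := y i - 1) \<in> V d l \<and> (y(i := y i - 1)) i < l i"
    using y(2) yl by auto
next
  fix x assume "x \<in> V d l" "\<not> x i < l i"
  then have "x i = l i" using V_le[of x d l i] i by simp
  then show "weight d \<beta> r l x * ((real (l i) - real (x i)) * (real (total d x) + \<beta> + 1)) *
      (F (x(i := x i + 1)) * G x) = 0" by simp
qed (simp_all add: finite_V)

lemma sum_weight_exchange:
  assumes nz: "pochhammer r (total d l) \<noteq> 0" and i: "i \<in> {1..d}" and j: "j \<in> {1..d}" and ij: "i \<noteq> j"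
  shows "(\<Sum>x\<in>V d l. weight d \<beta> r l x * (real (x j) * (real (l i) - real (x i))) *
      (F (x(i := x i + 1, j := x j - 1)) * G x)) =
    (\<Sum>x\<in>V d l. weight d \<beta> r l x * (real (x i) * (real (l j) - real (x j))) *
      (F x * G (x(j := x j + 1, i := x i - 1))))"
proof (rule sum_reindex_support[where P = "\<lambda>x. x i < l i \<and> 0 < x j" and Q = "\<lambda>y. y j < l j \<and> 0 < y i"
      and j = "\<lambda>x. x(i := x i + 1, j := x j - 1)" and i = "\<lambda>y. y(j := y j + 1, i := y i - 1)"])
  fix x assume x: "x \<in> V d l" "x i < l i \<and> 0 < x j"
  let ?y = "x(i := x i + 1, j := x j - 1)"
  have xj: "x j \<le> l j" using V_le[OF x(1) j] .
  have y: "?y \<in> V d l"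
    using V_update[OF V_update[OF x(1) i, of "x i + 1"] j, of "x j - 1"] x(2) xj by simp
  have inv: "?y(j := ?y j + 1, i := ?y i - 1) = x" using x(2) ij by auto
  have yi: "?y i = x i + 1" and yj: "?y j = x j - 1" using ij by simp_all
  show "?y(j := ?y j + 1, i := ?y i - 1) = x \<and> ?y \<in> V d l \<and> (?y j < l j \<and> 0 < ?y i) \<and>
      weight d \<beta> r l ?y * (real (?y i) * (real (l j) - real (?y j))) *
        (F ?y * G (?y(j := ?y j + 1, i := ?y i - 1))) =
      weight d \<beta> r l x * (real (x j) * (real (l i) - real (x i))) * (F ?y * G x)"
    unfolding inv weight_balance_exchange[OF nz x(1) i j ij conjunct1[OF x(2)] conjunct2[OF x(2)]]
    using y x(2) xj unfolding yi yj by (auto simp: of_nat_diff add.commute)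
next
  fix y assume y: "y \<in> V d l" "y j < l j \<and> 0 < y i"
  let ?x = "y(j := y j + 1, i := y i - 1)"
  have yi: "y i \<le> l i" using V_le[OF y(1) i] .
  have "?x \<in> V d l"
    using V_update[OF V_update[OF y(1) j, of "y j + 1"] i, of "y i - 1"] y(2) yi by simp
  then show "?x(i := ?x i + 1, j := ?x j - 1) = y \<and> ?x \<in> V d l \<and> ?x i < l i \<and> 0 < ?x j"
    using y(2) yi ij by auto
next
  fix x assume x: "x \<in> V d l" "\<not> (x i < l i \<and> 0 < x j)"
  then have "x i = l i \<or> x j = 0" using V_le[OF x(1) i] by auto
  then show "weight d \<beta> r l x * (real (x j) * (real (l i) - real (x i))) *
      (F (x(i := x i + 1, j := x j - 1)) * G x) = 0" by auto
next
  fix x assume x: "x \<in> V d l" "\<not> (x j < l j \<and> 0 < x i)"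
  then have "x j = l j \<or> x i = 0" using V_le[OF x(1) j] by auto
  then show "weight d \<beta> r l x * (real (x i) * (real (l j) - real (x j))) *
      (F x * G (x(j := x j + 1, i := x i - 1))) = 0" by auto
qed (simp_all add: finite_V)

theorem diffop_self_adjoint:
  assumes nz: "pochhammer r (total d l) \<noteq> 0"
  shows "(\<Sum>x\<in>V d l. diffop d \<beta> r l f (real \<circ> x) * g (real \<circ> x) * weight d \<beta> r l x) =
    (\<Sum>x\<in>V d l. f (real \<circ> x) * diffop d \<beta> r l g (real \<circ> x) * weight d \<beta> r l x)"
proof -
  let ?w = "weight d \<beta> r l"
  define A where "A i x = (real (l i) - real (x i)) * (real (total d x) + \<beta> + 1)" for i and x :: "nat \<Rightarrow> nat"
  define C where "C i x = real (x i) * (real (total d l) - real (total d x) + r)" for i and x :: "nat \<Rightarrow> nat"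
  define E where "E i j x = real (x j) * (real (l i) - real (x i))" for i j and x :: "nat \<Rightarrow> nat"
  define K where "K x = (\<Sum>i=1..d. A i x) + (\<Sum>i=1..d. C i x) -
    (\<Sum>i=1..d. \<Sum>j=1..d. if i = j then 0 else E i j x)" for x
  (* - K is the coefficient of the unshifted value; the three families of shifts give S1, S2, S3 *)
  let ?S1 = "\<lambda>F G. \<Sum>i=1..d. \<Sum>x\<in>V d l. ?w x * A i x * (F (x(i := x i + 1)) * G x)"
  let ?S2 = "\<lambda>F G. \<Sum>i=1..d. \<Sum>x\<in>V d l. ?w x * C i x * (F (x(i := x i - 1)) * G x)"
  let ?S3 = "\<lambda>F G. \<Sum>i=1..d. \<Sum>j=1..d. if i = j then 0 else
    \<Sum>x\<in>V d l. ?w x * E i j x * (F (x(i := x i + 1, j := x j - 1)) * G x)"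
  have form: "(\<Sum>x\<in>V d l. diffop d \<beta> r l f (real \<circ> x) * g (real \<circ> x) * ?w x) =
      ?S1 (\<lambda>x. f (real \<circ> x)) (\<lambda>x. g (real \<circ> x)) + ?S2 (\<lambda>x. f (real \<circ> x)) (\<lambda>x. g (real \<circ> x))
      - ?S3 (\<lambda>x. f (real \<circ> x)) (\<lambda>x. g (real \<circ> x)) -
      (\<Sum>x\<in>V d l. K x * (f (real \<circ> x) * g (real \<circ> x) * ?w x))" for f g
  proof -
    let ?F = "\<lambda>x. f (real \<circ> x)" and ?G = "\<lambda>x. g (real \<circ> x)"
    have u: "(real \<circ> x)(i := (real \<circ> x) i + 1) = real \<circ> x(i := x i + 1)" for x i
      by (auto simp: fun_eq_iff)
    have dn: "C i x * (f ((real \<circ> x)(i := (real \<circ> x) i - 1)) - e) = C i x * (?F (x(i := x i - 1)) - e)" for i x e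
    proof (cases "x i = 0")
      case False
      then have "(real \<circ> x)(i := (real \<circ> x) i - 1) = real \<circ> x(i := x i - 1)"
        by (auto simp: fun_eq_iff of_nat_diff)
      then show ?thesis by simp
    qed (simp add: C_def)
    have ex: "E i j x * (f ((real \<circ> x)(i := (real \<circ> x) i + 1, j := (real \<circ> x) j - 1)) - e) =
        E i j x * (?F (x(i := x i + 1, j := x j - 1)) - e)" for i j x e
    proof (cases "x j = 0")
      case False
      then have "(real \<circ> x)(i := (real \<circ> x) i + 1, j := (real \<circ> x) j - 1) =
          real \<circ> x(i := x i + 1, j := x j - 1)"
        by (auto simp: fun_eq_iff of_nat_diff)
      then show ?thesis by simp
    qed (simp add: E_def)
    have A': "(real (l i) - (real \<circ> x) i) * (total d (real \<circ> x) + \<beta> + 1) = A i x"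
      and C': "(real \<circ> x) i * (real (total d l) - total d (real \<circ> x) + r) = C i x"
      and E': "(real \<circ> x) j * (real (l i) - (real \<circ> x) i) = E i j x" for i j x
      by (simp_all add: A_def C_def E_def total_of_nat)
    have D: "diffop d \<beta> r l f (real \<circ> x) =
        (\<Sum>i=1..d. A i x * ?F (x(i := x i + 1))) + (\<Sum>i=1..d. C i x * ?F (x(i := x i - 1))) -
        (\<Sum>i=1..d. \<Sum>j=1..d. if i = j then 0 else E i j x * ?F (x(i := x i + 1, j := x j - 1))) -
        K x * ?F x" for x
    proof -
      have "diffop d \<beta> r l f (real \<circ> x) =
        (\<Sum>i=1..d. A i x * (?F (x(i := x i + 1)) - ?F x)) +
        (\<Sum>i=1..d. C i x * (?F (x(i := x i - 1)) - ?F x)) -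
        (\<Sum>i=1..d. \<Sum>j=1..d. if i = j then 0 else E i j x * (?F (x(i := x i + 1, j := x j - 1)) - ?F x))"
        unfolding diffop_expand A' C' E' dn ex unfolding u ..
      also have "(\<Sum>i=1..d. \<Sum>j=1..d. if i = j then 0 else E i j x * (?F (x(i := x i + 1, j := x j - 1)) - ?F x))
        = (\<Sum>i=1..d. \<Sum>j=1..d. (if i = j then 0 else E i j x * ?F (x(i := x i + 1, j := x j - 1))) -
            (if i = j then 0 else E i j x) * ?F x)"
        by (intro sum.cong refl) (auto simp: algebra_simps)
      finally show ?thesis
        unfolding K_def right_diff_distrib left_diff_distrib distrib_right sum_subtractf
          sum_distrib_right[symmetric] by linarith
    qed
    have "(\<Sum>x\<in>V d l. diffop d \<beta> r l f (real \<circ> x) * ?G x * ?w x) =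
      (\<Sum>x\<in>V d l. (\<Sum>i=1..d. ?w x * A i x * (?F (x(i := x i + 1)) * ?G x)) +
        (\<Sum>i=1..d. ?w x * C i x * (?F (x(i := x i - 1)) * ?G x)) -
        (\<Sum>i=1..d. \<Sum>j=1..d. if i = j then 0 else
          ?w x * E i j x * (?F (x(i := x i + 1, j := x j - 1)) * ?G x)) -
        K x * (?F x * ?G x * ?w x))"
      unfolding D left_diff_distrib distrib_right sum_distrib_right
      by (intro sum.cong refl arg_cong2[where f = "(-)"] arg_cong2[where f = "(+)"]) auto
    also have "\<dots> = (\<Sum>x\<in>V d l. \<Sum>i=1..d. ?w x * A i x * (?F (x(i := x i + 1)) * ?G x)) +
        (\<Sum>x\<in>V d l. \<Sum>i=1..d. ?w x * C i x * (?F (x(i := x i - 1)) * ?G x)) -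
        (\<Sum>x\<in>V d l. \<Sum>i=1..d. \<Sum>j=1..d. if i = j then 0 else
          ?w x * E i j x * (?F (x(i := x i + 1, j := x j - 1)) * ?G x)) -
        (\<Sum>x\<in>V d l. K x * (?F x * ?G x * ?w x))"
      by (simp only: sum_subtractf sum.distrib)
    also have "(\<Sum>x\<in>V d l. \<Sum>i=1..d. ?w x * A i x * (?F (x(i := x i + 1)) * ?G x)) = ?S1 ?F ?G"
      by (rule sum.swap)
    also have "(\<Sum>x\<in>V d l. \<Sum>i=1..d. ?w x * C i x * (?F (x(i := x i - 1)) * ?G x)) = ?S2 ?F ?G"
      by (rule sum.swap)
    also have "(\<Sum>x\<in>V d l. \<Sum>i=1..d. \<Sum>j=1..d. if i = j then 0 else
          ?w x * E i j x * (?F (x(i := x i + 1, j := x j - 1)) * ?G x)) =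
        (\<Sum>i=1..d. \<Sum>j=1..d. \<Sum>x\<in>V d l. if i = j then 0 else
          ?w x * E i j x * (?F (x(i := x i + 1, j := x j - 1)) * ?G x))"
      by (subst sum.swap) (intro sum.cong refl sum.swap)
    also have "\<dots> = ?S3 ?F ?G" by (intro sum.cong refl) simp
    finally show ?thesis .
  qed
  have S12: "?S1 F G = ?S2 G F" for F G
    unfolding A_def C_def
    by (rule sum.cong[OF refl], subst sum_weight_shift[OF nz], assumption,
        intro sum.cong refl, simp only: mult_ac)
  have S3: "?S3 F G = ?S3 G F" for F G
  proof -
    have "?S3 F G = (\<Sum>i=1..d. \<Sum>j=1..d. if j = i then 0 else
        \<Sum>x\<in>V d l. ?w x * E j i x * (G (x(j := x j + 1, i := x i - 1)) * F x))"
    proof (intro sum.cong refl)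
      fix i j assume i: "i \<in> {1..d}" and j: "j \<in> {1..d}"
      show "(if i = j then 0 else \<Sum>x\<in>V d l. ?w x * E i j x * (F (x(i := x i + 1, j := x j - 1)) * G x)) =
        (if j = i then 0 else \<Sum>x\<in>V d l. ?w x * E j i x * (G (x(j := x j + 1, i := x i - 1)) * F x))"
        using sum_weight_exchange[OF nz i j, of \<beta> F G]
        by (auto simp: E_def mult.commute[of "F _" "G _"])
    qed
    then show ?thesis by (subst sum.swap) simp
  qed
  let ?F = "\<lambda>x. f (real \<circ> x)" and ?G = "\<lambda>x. g (real \<circ> x)"
  have "(\<Sum>x\<in>V d l. K x * (?F x * ?G x * ?w x)) = (\<Sum>x\<in>V d l. K x * (?G x * ?F x * ?w x))"
    by (simp only: mult_ac)
  then have "(\<Sum>x\<in>V d l. diffop d \<beta> r l f (real \<circ> x) * g (real \<circ> x) * ?w x) =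
      (\<Sum>x\<in>V d l. diffop d \<beta> r l g (real \<circ> x) * f (real \<circ> x) * ?w x)"
    unfolding form S12[of ?F ?G] S12[of ?G ?F] S3[of ?F ?G] by linarith
  then show ?thesis by (simp add: mult_ac)
qed

section \<open>Positivity of the weight and the difference equation\<close>

lemma pochhammer_neg_sign:
  fixes z :: real
  assumes "z + real n < 1"
  shows "(- 1) ^ n * pochhammer z n > 0"
proof -
  have "(- 1) ^ n * pochhammer z n = pochhammer (- z - real n + 1) n"
    by (rule pochhammer_minus'[of "- z" n, simplified, symmetric])
  then show ?thesis using assms by (simp add: pochhammer_pos)
qed

lemma weight_pos:
  assumes par: "(\<beta> > -1 \<and> r > 0) \<or> (\<beta> < - real (total d l) \<and> r < - real (total d l) + 1)"
    and x: "x \<in> V d l"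
  shows "pochhammer r (total d l) \<noteq> 0" "weight d \<beta> r l x > 0"
proof -
  let ?X = "total d x" and ?L = "total d l"
  have XL: "?X \<le> ?L" using x by (rule V_total_le)
  show nz: "pochhammer r ?L \<noteq> 0"
    using par pochhammer_pos[of r ?L] pochhammer_neg_sign[of r ?L] by fastforce
  have P: "(\<Prod>i=1..d. real (l i choose x i)) > 0"
    using V_le[OF x] by (intro prod_pos) auto
  have "pochhammer (\<beta> + 1) ?X * pochhammer r (?L - ?X) / pochhammer r ?L > 0"
    using par
  proof
    assume "\<beta> > -1 \<and> r > 0"
    then show ?thesis by (simp add: pochhammer_pos)
  next
    assume h: "\<beta> < - real ?L \<and> r < - real ?L + 1"
    have 1: "(- 1) ^ ?X * pochhammer (\<beta> + 1) ?X > 0"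
      using h XL by (intro pochhammer_neg_sign) linarith
    have 2: "(- 1) ^ (?L - ?X) * pochhammer r (?L - ?X) > 0"
      using h XL by (intro pochhammer_neg_sign) linarith
    have 3: "(- 1) ^ ?L * pochhammer r ?L > 0"
      using h by (intro pochhammer_neg_sign) linarith
    have e: "(- 1 :: real) ^ ?L = (- 1) ^ ?X * (- 1) ^ (?L - ?X)"
      using XL by (simp flip: power_add)
    have "(- 1 :: real) ^ ?X \<noteq> 0" "(- 1 :: real) ^ (?L - ?X) \<noteq> 0" by simp_all
    then have "pochhammer (\<beta> + 1) ?X * pochhammer r (?L - ?X) / pochhammer r ?L =
        ((- 1) ^ ?X * pochhammer (\<beta> + 1) ?X) * ((- 1) ^ (?L - ?X) * pochhammer r (?L - ?X)) /
        ((- 1) ^ ?L * pochhammer r ?L)"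
      unfolding e by simp
    then show ?thesis using 1 2 3 by simp
  qed
  from mult_pos_pos[OF P this] show "weight d \<beta> r l x > 0"
    unfolding weight_eq[OF nz x] by (simp only: times_divide_eq_right mult.assoc)
qed

theorem diffop_phi_poly:
  assumes par: "(\<beta> > -1 \<and> r > 0) \<or> (\<beta> < - real (total d l) \<and> r < - real (total d l) + 1)"
    and \<nu>: "\<nu> \<in> V d l" and x: "x \<in> V d l"
  shows "diffop d \<beta> r l (phi_poly d \<beta> r l \<nu>) (real \<circ> x) =
    eigval \<beta> r (total d \<nu>) * phi_poly d \<beta> r l \<nu> (real \<circ> x)"
proof -
  let ?p = "phi_poly d \<beta> r l \<nu>" and ?w = "weight d \<beta> r l"
  have nz: "pochhammer r (total d l) \<noteq> 0" using weight_pos(1)[OF par x] .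
  obtain g where g: "deg_less d (total d \<nu>) g"
    and Dp: "\<And>x. diffop d \<beta> r l ?p x = eigval \<beta> r (total d \<nu>) * ?p x + g x"
    using diffop_leading_term[OF deg_less_phi_poly] by blast
  have orth: "(\<Sum>x\<in>V d l. ?p (real \<circ> x) * q (real \<circ> x) * ?w x) = 0" if "deg_less d (total d \<nu>) q" for q
    using phi_poly_orthogonal_lower_degree[OF nz _ that] V_le[OF \<nu>] by blast
  have "(\<Sum>x\<in>V d l. (g (real \<circ> x))\<^sup>2 * ?w x) =
      (\<Sum>x\<in>V d l. diffop d \<beta> r l ?p (real \<circ> x) * g (real \<circ> x) * ?w x) -
      eigval \<beta> r (total d \<nu>) * (\<Sum>x\<in>V d l. ?p (real \<circ> x) * g (real \<circ> x) * ?w x)"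
    unfolding Dp sum_distrib_left sum_subtractf[symmetric]
    by (intro sum.cong refl) (simp add: power2_eq_square algebra_simps)
  also have "\<dots> = 0"
    unfolding diffop_self_adjoint[OF nz] orth[OF g] orth[OF deg_less_diffop[OF g]] by simp
  finally have "(\<Sum>x\<in>V d l. (g (real \<circ> x))\<^sup>2 * ?w x) = 0" .
  moreover have "0 \<le> (g (real \<circ> y))\<^sup>2 * ?w y" if "y \<in> V d l" for y
    using weight_pos(2)[OF par that] by simp
  ultimately have "(g (real \<circ> x))\<^sup>2 * ?w x = 0"
    using sum_nonneg_eq_0_iff[OF finite_V, of d l "\<lambda>x. (g (real \<circ> x))\<^sup>2 * ?w x"] x by blast
  then have "g (real \<circ> x) = 0" using weight_pos(2)[OF par x] by simp
  then show ?thesis unfolding Dp by simp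
qed

theorem theorem5p3:
  fixes d :: nat and l :: "nat \<Rightarrow> nat" and \<beta> r :: real
  assumes "d > 1"
    and "(\<beta> > -1 \<and> r > 0) \<or> (\<beta> < - real (total d l) \<and> r < - real (total d l) + 1)"
  shows "(\<forall>\<nu> \<in> V d l. \<forall>x \<in> V d l.
            diffop d \<beta> r l (phi d \<beta> r l \<nu>) (real \<circ> x) =
              eigval \<beta> r (total d \<nu>) * phi d \<beta> r l \<nu> (real \<circ> x)) \<and>
         (\<forall>\<nu> \<in> V d l. \<forall>\<mu> \<in> V d l.
            (\<Sum>x \<in> V d l. phi d \<beta> r l \<nu> (real \<circ> x) * phi d \<beta> r l \<mu> (real \<circ> x) * weight d \<beta> r l x) =
              B d \<beta> r l \<nu> * (if \<nu> = \<mu> then 1 else 0))"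
proof (intro conjI ballI)
  fix \<nu> x assume \<nu>: "\<nu> \<in> V d l" and x: "x \<in> V d l"
  note p = phi_eq_phi_poly[OF assms(2) \<nu>]
  have "diffop d \<beta> r l (phi d \<beta> r l \<nu>) (real \<circ> x) = diffop d \<beta> r l (phi_poly d \<beta> r l \<nu>) (real \<circ> x)"
    by (rule diffop_cong[OF x]) (rule p)
  also have "\<dots> = eigval \<beta> r (total d \<nu>) * phi d \<beta> r l \<nu> (real \<circ> x)"
    unfolding p[OF x] by (rule diffop_phi_poly[OF assms(2) \<nu> x])
  finally show "diffop d \<beta> r l (phi d \<beta> r l \<nu>) (real \<circ> x) =
      eigval \<beta> r (total d \<nu>) * phi d \<beta> r l \<nu> (real \<circ> x)" .
next
  fix \<nu> \<mu> assume \<nu>: "\<nu> \<in> V d l" and \<mu>: "\<mu> \<in> V d l"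
  have "(\<forall>i\<in>{1..d}. \<nu> i = \<mu> i) \<longleftrightarrow> \<nu> = \<mu>"
    using \<nu> \<mu> unfolding V_def by (auto intro: PiE_ext)
  then show "(\<Sum>x \<in> V d l. phi d \<beta> r l \<nu> (real \<circ> x) * phi d \<beta> r l \<mu> (real \<circ> x) * weight d \<beta> r l x) =
      B d \<beta> r l \<nu> * (if \<nu> = \<mu> then 1 else 0)"
    using phi_poly_orthogonal[OF weight_pos(1)[OF assms(2) \<nu>] V_le[OF \<nu>] V_le[OF \<mu>], of \<beta>]
    by (simp add: phi_eq_phi_poly[OF assms(2) \<nu>] phi_eq_phi_poly[OF assms(2) \<mu>])
qed

end
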